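(* Let $d$ be an odd integer, $G=\mathbb{Z}/d\mathbb{Z}$, and let $a,b$ be positive integers with $a+b=d$ and $a\equiv \frac{(d+1)^2}{4} \pmod 4$. Then both values $\sqrt{a}+i\sqrt{b}$ and $\sqrt{a}-i\sqrt{b}$ belong to $\mathcal{B}_d^o$.
   Context: For a function $f:\mathbb{Z}/d\mathbb{Z}\to\mathbb{C}$, the convolution is $f*f(k)=\sum_{\ell\in\mathbb{Z}/d\mathbb{Z}} f(\ell)f(k-\ell)$. For $\lambda\in\mathbb{C}$, a function $f$ is called $\lambda$-critical if $f\neq 0$ and $f*f(2k)=\lambda f(k)^2$ for all $k\in\mathbb{Z}/d\mathbb{Z}$; $\lambda$ is called $d$-critical if a $\lambda$-critical function exists. The conjugate Fourier transform of $f$ is $\widetilde f(k)=\frac{1}{\sqrt d}\sum_{\ell\in\mathbb{Z}/d\mathbb{Z}} e^{2i\pi k\ell/d}\,\overline{f(\ell)}$. The set $\mathcal{B}_d^o$ consists of all $\lambda\in\mathbb{C}$ for which there exists a $\lambda$-critical function $f$ on $\mathbb{Z}/d\mathbb{Z}$ with $\widetilde f=f$. Here $\sqrt a,\sqrt b$ denote positive square roots. *)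

theory Defs
  imports Complex_Main "HOL-Number_Theory.Cong"
begin

text \<open>
  A function on the cyclic group of integers modulo \<open>d\<close> is represented by its pullback to the
  integers, i.e. by a \<open>d\<close>-periodic function on \<open>int\<close>. Sums over the group are taken over the
  representatives \<open>{0..<int d}\<close>; the summands below are \<open>d\<close>-periodic, so this choice does not matter.
  All notions are intended for \<open>d > 0\<close>.
\<close>

definition zmod_funs :: "nat \<Rightarrow> (int \<Rightarrow> complex) set" where
  "zmod_funs d = {f. \<forall>k. f (k + int d) = f k}"

definition convolution :: "nat \<Rightarrow> (int \<Rightarrow> complex) \<Rightarrow> (int \<Rightarrow> complex) \<Rightarrow> int \<Rightarrow> complex" where
  "convolution d f g k = (\<Sum>l\<in>{0..<int d}. f l * g (k - l))"

definition critical_fun :: "nat \<Rightarrow> complex \<Rightarrow> (int \<Rightarrow> complex) \<Rightarrow> bool" where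
  "critical_fun d z f \<longleftrightarrow>
     f \<in> zmod_funs d \<and> f \<noteq> (\<lambda>_. 0) \<and> (\<forall>k. convolution d f f (2 * k) = z * (f k)\<^sup>2)"

definition conj_fourier :: "nat \<Rightarrow> (int \<Rightarrow> complex) \<Rightarrow> int \<Rightarrow> complex" where
  "conj_fourier d f k =
     1 / complex_of_real (sqrt (real d)) *
     (\<Sum>l\<in>{0..<int d}.
        exp (2 * \<i> * complex_of_real pi * of_int k * of_int l / of_nat d) * cnj (f l))"

definition B_o :: "nat \<Rightarrow> complex set" where
  "B_o d = {z. \<exists>f. critical_fun d z f \<and> conj_fourier d f = f}"

end

theory Submission
  imports Defs "HOL-Probability.Characteristic_Functions" "HOL-Complex_Analysis.Conformal_Mappings"
begin

text \<open>
  Put \<open>\<mu> = \<surd>a + \<i>\<surd>b\<close>, so that \<open>|\<mu>|\<^sup>2 = d\<close>, and \<open>\<sigma> = (1 - 1/\<mu>\<^sup>2)/4\<close>, a point of the upper half plane.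
  The function \<open>f(k)\<close> is the theta series of \<open>E(m) = exp(\<pi>\<i>\<sigma>m\<^sup>2)\<close> over \<open>m \<equiv> k\<close> mod \<open>d\<close>. The identity
  \<open>m\<^sup>2 + n\<^sup>2 = ((m+n)\<^sup>2 + (m-n)\<^sup>2)/2\<close> reduces the equation \<open>f*f(2k) = \<mu> f(k)\<^sup>2\<close> to
  \<open>\<theta>(\<sigma>) = \<mu> \<theta>(d\<^sup>2\<sigma>)\<close> for the two series \<open>\<theta>(s) = \<Sum> exp(\<pi>\<i>st\<^sup>2/2)\<close> over even and over odd \<open>t\<close>.
  Now \<open>\<sigma>\<close> is a complex multiplication point: \<open>d\<^sup>2\<sigma>\<close> and \<open>\<sigma>\<close> are related by an element of \<open>\<Gamma>(4)\<close> with
  automorphy factor \<open>\<mu>\<^sup>2\<close>, which is where \<open>16\<close> has to divide \<open>(d+1)\<^sup>2 - 4a\<close>. Concretely, both this relation and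
  the relation of the conjugate Fourier transform of \<open>f\<close> to \<open>k \<mapsto> f(4k)\<close> are a single Poisson
  summation, with a Gauss sum modulo \<open>8\<close> resp. \<open>4\<close> absorbing the term \<open>1/4\<close> of \<open>\<sigma>\<close>. Hence \<open>g(k) = f(2k)\<close>
  is its own conjugate Fourier transform up to a factor of modulus 1, which a scalar multiple removes.
\<close>

subsection \<open>Uniqueness of Fourier coefficients\<close>

text \<open>The inductive form reduces statements that are linear in the function to single
  characters; closure under products is derived afterwards.\<close>

inductive trig_poly :: "(real \<Rightarrow> complex) \<Rightarrow> bool" where
  monomial: "trig_poly (\<lambda>x. c * cis (2 * pi * of_int m * x))"
| add: "trig_poly f \<Longrightarrow> trig_poly g \<Longrightarrow> trig_poly (\<lambda>x. f x + g x)"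

lemma trig_poly_const: "trig_poly (\<lambda>x. c)"
  using trig_poly.monomial[of c 0] by simp

lemma trig_poly_mult:
  assumes "trig_poly f" "trig_poly g"
  shows "trig_poly (\<lambda>x. f x * g x)"
  using assms
proof (induction f)
  case (monomial c m)
  from monomial(1) show ?case
  proof (induction g)
    case (monomial c' m')
    have "(\<lambda>x. c * cis (2 * pi * of_int m * x) * (c' * cis (2 * pi * of_int m' * x)))
        = (\<lambda>x. (c * c') * cis (2 * pi * of_int (m + m') * x))"
      by (intro ext) (simp add: cis_mult algebra_simps flip: cis_mult)
    then show ?case by (simp only: trig_poly.monomial)
  qed (auto simp: distrib_left intro: trig_poly.add)
qed (auto simp: distrib_right intro: trig_poly.add)

lemma trig_poly_cnj: "trig_poly f \<Longrightarrow> trig_poly (\<lambda>x. cnj (f x))"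
proof (induction rule: trig_poly.induct)
  case (monomial c m)
  have "(\<lambda>x. cnj (c * cis (2 * pi * of_int m * x))) = (\<lambda>x. cnj c * cis (2 * pi * of_int (- m) * x))"
    by (simp add: cis_cnj)
  then show ?case by (simp only: trig_poly.monomial)
qed (auto intro: trig_poly.add)

text \<open>A real linear functional is a combination of \<open>Re\<close> and \<open>Im\<close>,
  and on the unit circle these are combinations of \<open>cis t\<close> and
  \<open>cis (- t)\<close>. So the polynomials supplied by Stone-Weierstrass become trigonometric
  polynomials.\<close>

lemma trig_poly_real_polynomial_function:
  fixes p :: "complex \<Rightarrow> real"
  assumes "real_polynomial_function p"
  shows "trig_poly (\<lambda>x. of_real (p (cis (2 * pi * x))))"
  using assms
proof (induction p)
  case (linear f)
  interpret bounded_linear f by fact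
  have f: "f z = Re z * f 1 + Im z * f \<i>" for z
  proof -
    have "f z = f (Re z *\<^sub>R 1 + Im z *\<^sub>R \<i>)" by (metis complex_eq scaleR_conv_of_real mult.right_neutral mult.commute)
    then show ?thesis by (simp only: add scaleR) simp
  qed
  have Re_e: "of_real (Re (cis t)) = (1/2) * cis t + (1/2) * cis (- t)"
    and Im_e: "of_real (Im (cis t)) = (- \<i>/2) * cis t + (\<i>/2) * cis (- t)" for t
    by (auto simp: complex_eq_iff)
  have "(\<lambda>x. of_real (f (cis (2 * pi * x)))) = 
     (\<lambda>x. of_real (f 1) * ((1/2) * cis (2 * pi * of_int 1 * x) + (1/2) * cis (2 * pi * of_int (-1) * x))
        + of_real (f \<i>) * ((- \<i>/2) * cis (2 * pi * of_int 1 * x) + (\<i>/2) * cis (2 * pi * of_int (-1) * x)))"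
    by (intro ext, subst f, simp only: of_real_add of_real_mult Re_e Im_e) (simp add: algebra_simps)
  moreover have "trig_poly \<dots>"
    by (intro trig_poly.add trig_poly_mult trig_poly_const trig_poly.monomial)
  ultimately show ?case by simp
qed (auto intro: trig_poly.add trig_poly_mult trig_poly_const)

lemma has_integral_mult_trig_poly:
  assumes D: "\<And>m::int. ((\<lambda>x. D x * cis (2 * pi * of_int m * x)) has_integral 0) {0..1}"
    and "trig_poly g"
  shows "((\<lambda>x. D x * g x) has_integral 0) {0..1}"
  using assms(2)
proof (induction g)
  case (monomial c m)
  show ?case using has_integral_mult_right[OF D[of m], of c] by (simp add: algebra_simps)
next
  case (add f g)
  show ?case using has_integral_add[OF add.IH] by (simp add: algebra_simps)
qed

lemma periodic_int:
  fixes D :: "real \<Rightarrow> 'a"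
  assumes "\<And>x. D (x + 1) = D x"
  shows "D (x + of_int n) = D x"
proof -
  have 1: "D (x + of_nat n) = D x" for x n
  proof (induction n)
    case (Suc n)
    have "D (x + of_nat (Suc n)) = D ((x + of_nat n) + 1)" by (simp add: algebra_simps)
    then show ?case using assms Suc by metis
  qed simp
  show ?thesis
  proof (cases "n \<ge> 0")
    case True then show ?thesis using 1[of x "nat n"] by simp
  next
    case False
    then show ?thesis using 1[of "x + of_int n" "nat (-n)"] by simp
  qed
qed

text \<open>Stone-Weierstrass on the unit circle: a function of period 1 descends to the circle
  through the argument.\<close>

lemma trig_poly_dense:
  fixes D :: "real \<Rightarrow> complex"
  assumes cont: "continuous_on UNIV D" and per: "\<And>x. D (x + 1) = D x" and "\<epsilon> > 0"
  obtains g where "trig_poly g" "\<And>x. norm (D x - g x) < \<epsilon>"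
proof -
  define f where "f w = D (Arg2pi w / (2 * pi))" for w
  have f_cis: "f (cis (2 * pi * x)) = D x" for x
  proof -
    have "exp (\<i> * of_real (Arg2pi (cis (2 * pi * x)))) = exp (\<i> * of_real (2 * pi * x))"
      using Arg2pi_eq[of "cis (2 * pi * x)"] by (simp add: cis_conv_exp)
    then obtain n :: int where n: "\<i> * of_real (Arg2pi (cis (2 * pi * x))) = \<i> * of_real (2 * pi * x) + of_int (2 * n) * pi * \<i>"
      using exp_eq by blast
    then have "Im (\<i> * of_real (Arg2pi (cis (2 * pi * x)))) = Im (\<i> * of_real (2 * pi * x) + of_int (2 * n) * pi * \<i>)"
      by simp
    then have "Arg2pi (cis (2 * pi * x)) = 2 * pi * (x + of_int n)"
      by (simp add: algebra_simps)
    then show ?thesis by (simp add: f_def periodic_int[of D, OF per])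
  qed
  have D_Arg: "D (Arg w / (2 * pi)) = f w" if "w \<noteq> 0" for w
  proof -
    have "w = of_real (norm w) * cis (2 * pi * (Arg w / (2 * pi)))"
      using Arg_eq[OF that] by (simp add: cis_conv_exp)
    then have "Arg2pi w = Arg2pi (cis (2 * pi * (Arg w / (2 * pi))))"
      using that by (metis Arg2pi_times_of_real zero_less_norm_iff)
    then show ?thesis using f_cis[of "Arg w / (2 * pi)"] by (simp add: f_def)
  qed
  have D_cont: "isCont D y" for y using cont by (simp add: continuous_on_eq_continuous_at)
  \<comment> \<open>\<open>Arg2pi\<close> jumps on the positive real axis and \<open>Arg\<close> on
    the negative one. By periodicity of \<open>D\<close> both define the same \<open>f\<close>, so
    each branch covers the cut of the other.\<close>
  have "isCont f w" if "w \<noteq> 0" for w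
  proof (cases "w \<in> \<real>\<^sub>\<ge>\<^sub>0")
    case False
    have "isCont (\<lambda>w. Arg2pi w / (2 * pi)) w"
      using continuous_at_Arg2pi[OF False] by (intro continuous_intros) auto
    then show ?thesis unfolding f_def by (rule isCont_o2) (rule D_cont)
  next
    case True
    then have nw: "w \<notin> \<real>\<^sub>\<le>\<^sub>0" using that
      by (auto simp: complex_nonneg_Reals_iff complex_nonpos_Reals_iff complex_eq_iff)
    have "isCont (\<lambda>w. Arg w / (2 * pi)) w"
      using continuous_at_Arg[OF nw] by (intro continuous_intros) auto
    then have "isCont (\<lambda>w. D (Arg w / (2 * pi))) w" by (rule isCont_o2) (rule D_cont)
    moreover have "\<forall>\<^sub>F v in nhds w. D (Arg v / (2 * pi)) = f v"
      using t1_space_nhds[of w "0"] that D_Arg by (auto elim: eventually_mono)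
    ultimately show ?thesis by (simp add: isCont_cong)
  qed
  then have "continuous_on (sphere 0 1) f"
    by (intro continuous_at_imp_continuous_on ballI) (metis dist_0_norm mem_sphere norm_zero zero_neq_one)
  then obtain g where g: "polynomial_function g" "\<And>w. w \<in> sphere 0 1 \<Longrightarrow> norm (f w - g w) < \<epsilon>"
    using Stone_Weierstrass_polynomial_function[of "sphere (0::complex) 1" f \<epsilon>] \<open>\<epsilon> > 0\<close> by auto
  have "trig_poly (\<lambda>x. of_real ((Re \<circ> g) (cis (2 * pi * x))) + \<i> * of_real ((Im \<circ> g) (cis (2 * pi * x))))"
    using g(1) bounded_linear_Re bounded_linear_Im unfolding polynomial_function_def
    by (intro trig_poly.add trig_poly_mult trig_poly_const trig_poly_real_polynomial_function) blast+
  then have "trig_poly (\<lambda>x. g (cis (2 * pi * x)))" by (simp flip: complex_eq)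
  moreover have "norm (D x - g (cis (2 * pi * x))) < \<epsilon>" for x
    using g(2)[of "cis (2 * pi * x)"] by (simp add: f_cis)
  ultimately show thesis by (rule that)
qed

text \<open>\<open>D\<close> is orthogonal to all trigonometric polynomials, hence by density to
  itself, and a continuous function with vanishing integral of |D|^2 is 0.\<close>

lemma fourier_coeffs_zero_imp_zero:
  fixes D :: "real \<Rightarrow> complex"
  assumes cont: "continuous_on UNIV D" and per: "\<And>x. D (x + 1) = D x"
    and coeff: "\<And>m::int. ((\<lambda>x. D x * cis (2 * pi * of_int m * x)) has_integral 0) {0..1}"
  shows "D x = 0"
proof -
  have contI: "continuous_on {0..1} D" using cont continuous_on_subset by blast
  have int2: "((\<lambda>x. D x * cnj (D x)) has_integral 0) {0..1}"
  proof -
    have "(\<lambda>x. D x * cnj (D x)) integrable_on {0..1}"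
      by (intro integrable_continuous_interval continuous_intros contI)
    then obtain I where I: "((\<lambda>x. D x * cnj (D x)) has_integral I) {0..1}" by blast
    have "bounded (D ` {0..1})" using contI by (intro compact_imp_bounded compact_continuous_image) auto
    then obtain B where B: "B > 0" "\<And>x. x \<in> {0..1} \<Longrightarrow> norm (D x) \<le> B"
      by (metis bounded_pos imageI)
    \<comment> \<open>Subtracting \<open>cnj (g x)\<close> does not change the integral, since
      \<open>D\<close> is orthogonal to \<open>g\<close>, and leaves an integrand of norm at most
      \<epsilon>.\<close>
    have "norm I \<le> \<epsilon>" if e0: "\<epsilon> > 0" for \<epsilon>
    proof -
      obtain g where g: "trig_poly g" "\<And>x. norm (D x - g x) < \<epsilon> / B"
        using trig_poly_dense[of D, OF cont per divide_pos_pos[OF e0 B(1)]] by metis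
      have "((\<lambda>x. D x * cnj (g x)) has_integral 0) {0..1}"
        by (rule has_integral_mult_trig_poly[OF coeff trig_poly_cnj[OF g(1)]])
      from has_integral_diff[OF I this]
      have h: "((\<lambda>x. D x * cnj (D x - g x)) has_integral I) {0..1}" by (simp add: algebra_simps)
      have "norm I \<le> B * (\<epsilon> / B) * measure lborel (cbox 0 (1::real))"
      proof (rule has_integral_bound)
        show "((\<lambda>x. D x * cnj (D x - g x)) has_integral I) (cbox 0 1)" using h by simp
        show "norm (D x * cnj (D x - g x)) \<le> B * (\<epsilon> / B)" if "x \<in> cbox 0 1" for x
          unfolding norm_mult complex_mod_cnj using that B g(2)[of x] by (intro mult_mono) auto
      qed (use B that in auto)
      then show ?thesis using B by simp
    qed
    then have "norm I \<le> 0" by (rule field_le_epsilon) simp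
    then show ?thesis using I by simp
  qed
  have "((\<lambda>x. (norm (D x))\<^sup>2) has_integral 0) {0..1}"
    using has_integral_Re[OF int2] unfolding cmod_power2 by (simp add: power2_eq_square)
  then have "integral {0..1} (\<lambda>x. (norm (D x))\<^sup>2) = 0" by (rule integral_unique)
  moreover have "continuous_on {0..1} (\<lambda>x. (norm (D x))\<^sup>2)" by (intro continuous_intros contI)
  ultimately have z: "D y = 0" if "y \<in> {0..1}" for y
    using integral_eq_0_iff[of 0 1 "\<lambda>x. (norm (D x))\<^sup>2"] that by auto
  have "D x = D (frac x)" using periodic_int[of D, OF per, of "frac x" "\<lfloor>x\<rfloor>"] by (simp add: frac_def)
  also have "\<dots> = 0" by (rule z) (auto simp: frac_ge_0 less_imp_le[OF frac_lt_1])
  finally show ?thesis .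
qed

subsection \<open>Poisson summation for Gaussians\<close>

lemma summable_on_exp_abs_int:
  fixes c :: real
  assumes "c > 0"
  shows "(\<lambda>n::int. exp (- c * \<bar>of_int n\<bar>)) summable_on UNIV"
proof -
  have r: "(\<lambda>n::nat. exp (- c) ^ n) summable_on UNIV"
    using assms by (intro norm_summable_imp_summable_on) (simp add: norm_power summable_geometric)
  have e: "exp (- (c * real n)) = exp (- c) ^ n" for n
    using exp_of_nat_mult[of n "- c"] by (simp add: mult.commute)
  have "(\<lambda>n::int. exp (- c * \<bar>of_int n\<bar>)) summable_on range int"
    using r by (subst summable_on_reindex) (auto simp: o_def e)
  moreover have "(\<lambda>n::int. exp (- c * \<bar>of_int n\<bar>)) summable_on range (\<lambda>n. - int n)"
    using r by (subst summable_on_reindex) (auto simp: o_def e inj_on_def)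
  moreover have "range int \<union> range (\<lambda>n. - int n) = UNIV"
    by (auto simp: image_iff) (metis int_cases2)
  ultimately show ?thesis using summable_on_union by metis
qed

lemma abs_of_int_le_power2: "\<bar>real_of_int n\<bar> \<le> (real_of_int n)\<^sup>2"
proof -
  have "\<bar>n\<bar> \<le> n\<^sup>2"
    using self_le_power[of "\<bar>n\<bar>" 2] by (cases "n = 0") auto
  then show ?thesis by (metis of_int_abs of_int_le_iff of_int_power)
qed

text \<open>Dominates the Gaussian terms by a geometric series uniformly in \<open>a\<close> and
  \<open>x\<close>, as the M-test requires. It rests on |n| <= n^2 <= 2(n+x)^2 + 2x^2.\<close>

lemma exp_gauss_bound:
  fixes a x X :: real and n :: int
  assumes "a \<ge> c" "c \<ge> 0" "\<bar>x\<bar> \<le> X"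
  shows "exp (- pi * a * (of_int n + x)\<^sup>2) \<le> exp (pi * c * X\<^sup>2) * exp (- (pi * c / 2) * \<bar>of_int n\<bar>)"
proof -
  note abs_of_int_le_power2[of n]
  moreover have "(real_of_int n)\<^sup>2 \<le> 2 * (of_int n + x)\<^sup>2 + 2 * x\<^sup>2"
    using zero_le_power2[of "real_of_int n + 2 * x"] by (simp add: power2_eq_square algebra_simps)
  moreover have "x\<^sup>2 \<le> X\<^sup>2" using assms by (metis abs_le_square_iff abs_of_nonneg abs_ge_zero order.trans)
  ultimately have "\<bar>real_of_int n\<bar> / 2 - X\<^sup>2 \<le> (of_int n + x)\<^sup>2" by linarith
  then have "c * (\<bar>real_of_int n\<bar> / 2 - X\<^sup>2) \<le> c * (of_int n + x)\<^sup>2" using assms by (intro mult_left_mono)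
  also have "\<dots> \<le> a * (of_int n + x)\<^sup>2" using assms by (intro mult_right_mono) auto
  finally have "pi * (c * (\<bar>real_of_int n\<bar> / 2 - X\<^sup>2)) \<le> pi * (a * (of_int n + x)\<^sup>2)" by (intro mult_left_mono) auto
  then show ?thesis by (simp add: exp_add[symmetric] algebra_simps)
qed

text \<open>Uniform convergence allows termwise integration, and the integer translates of the unit
  interval tile the line. Dominated convergence gives the limit of the integrals over
  [-N, N].\<close>

lemma has_integral_periodization:
  fixes \<psi> :: "real \<Rightarrow> complex"
  assumes cont: "continuous_on UNIV \<psi>" and int: "integrable lborel \<psi>"
    and bound: "\<And>n x. x \<in> {0..1} \<Longrightarrow> norm (\<psi> (of_int n + x)) \<le> M n" and M: "M summable_on UNIV"
  shows "((\<lambda>x. \<Sum>\<^sub>\<infinity>n::int. \<psi> (of_int n + x)) has_integral (LINT x|lborel. \<psi> x)) {0..1}"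
proof -
  have c1: "continuous_on S (\<lambda>x. \<psi> (of_int n + x))" for n :: int and S
    by (rule continuous_on_compose2[OF cont]) (auto intro!: continuous_intros)
  have "uniform_limit {0..1} (\<lambda>X x. \<Sum>n\<in>X. \<psi> (of_int n + x)) (\<lambda>x. \<Sum>\<^sub>\<infinity>n::int. \<psi> (of_int n + x)) (finite_subsets_at_top UNIV)"
    by (rule Weierstrass_m_test_general[OF _ M]) (use bound in auto)
  then obtain I J where I: "\<And>X. ((\<lambda>x. \<Sum>n\<in>X. \<psi> (of_int n + x)) has_integral I X) {0..1}"
    and J: "((\<lambda>x. \<Sum>\<^sub>\<infinity>n::int. \<psi> (of_int n + x)) has_integral J) {0..1}"
    and IJ: "(I \<longlongrightarrow> J) (finite_subsets_at_top UNIV)"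
    by (rule uniform_limit_integral) (auto intro!: continuous_intros c1)
  \<comment> \<open>Symmetric blocks eventually contain every finite set of integers, so the
    unordered limit can be read along the sequence of blocks.\<close>
  have "filterlim (\<lambda>N. {- int N..<int N}) (finite_subsets_at_top UNIV) sequentially"
    unfolding filterlim_finite_subsets_at_top
  proof (intro allI impI)
    fix X :: "int set" assume "finite X \<and> X \<subseteq> UNIV"
    then have "finite X" by simp
    define B where "B = Max (insert 0 (abs ` X)) + 1"
    have B: "\<bar>x\<bar> < B" if "x \<in> X" for x
      using Max_ge[of "insert 0 (abs ` X)" "\<bar>x\<bar>"] that \<open>finite X\<close> by (simp add: B_def)
    show "\<forall>\<^sub>F N in sequentially. finite {- int N..<int N} \<and> X \<subseteq> {- int N..<int N} \<and> {- int N..<int N} \<subseteq> UNIV"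
      using eventually_ge_at_top[of "nat B"] by eventually_elim (use B in \<open>fastforce simp: abs_less_iff\<close>)
  qed
  with IJ have lim1: "(\<lambda>N. I {- int N..<int N}) \<longlonglongrightarrow> J" by (rule filterlim_compose)
  have IN: "(\<psi> has_integral I {- int N..<int N}) {- real N..real N}" for N
  proof (induction N)
    case 0
    have "I {} = 0" using has_integral_unique[OF I[of "{}"], of 0] by simp
    then show ?case by (simp add: has_integral_refl)
  next
    case (Suc N)
    have sh: "(\<psi> has_integral integral {0..1} (\<lambda>x. \<psi> (of_int n + x))) {of_int n..of_int n + 1}" for n :: int
    proof -
      have "((\<lambda>x. \<psi> (of_int n + x)) has_integral integral {0..1} (\<lambda>x. \<psi> (of_int n + x))) {0..1}"
        by (intro integrable_integral integrable_continuous_interval c1)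
      from has_integral_affinity[where m=1 and c="- real_of_int n" and f="\<lambda>x. \<psi> (of_int n + x)" and a=0 and b="1::real"] this
      have "((\<lambda>x. \<psi> x) has_integral integral {0..1} (\<lambda>x. \<psi> (of_int n + x))) ((\<lambda>x. x + of_int n) ` {0..1})"
        by (simp add: o_def)
      also have "(\<lambda>x. x + real_of_int n) ` {0..1} = {of_int n..of_int n + 1}"
        using image_add_atLeastAtMost[of "real_of_int n" 0 1] by (simp add: add.commute)
      finally show ?thesis by simp
    qed
    have I_sum: "I X = (\<Sum>n\<in>X. integral {0..1} (\<lambda>x. \<psi> (of_int n + x)))" if "finite X" for X
    proof (rule has_integral_unique[OF I], rule has_integral_sum[OF that])
      show "((\<lambda>x. \<psi> (of_int n + x)) has_integral integral {0..1} (\<lambda>x. \<psi> (of_int n + x))) {0..1}" for n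
        by (intro integrable_integral integrable_continuous_interval c1)
    qed
    have set: "{- int (Suc N)..<int (Suc N)} = insert (- int N - 1) (insert (int N) {- int N..<int N})" by auto
    have I_Suc: "I {- int (Suc N)..<int (Suc N)} = integral {0..1} (\<lambda>x. \<psi> (of_int (- int N - 1) + x)) + I {- int N..<int N} + integral {0..1} (\<lambda>x. \<psi> (of_int (int N) + x))"
      unfolding set by (subst (1 2) I_sum) (auto simp: algebra_simps)
    have L: "(\<psi> has_integral (integral {0..1} (\<lambda>x. \<psi> (of_int (- int N - 1) + x)) + I {- int N..<int N})) {- real N - 1..real N}"
      by (rule has_integral_combine[of _ "- real N"]) (use sh[of "- int N - 1"] Suc in auto)
    have "(\<psi> has_integral (integral {0..1} (\<lambda>x. \<psi> (of_int (- int N - 1) + x)) + I {- int N..<int N} + integral {0..1} (\<lambda>x. \<psi> (of_int (int N) + x)))) {- real N - 1..real N + 1}"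
      by (rule has_integral_combine[of _ "real N"]) (use L sh[of "int N"] in auto)
    moreover have "{- real (Suc N)..real (Suc N)} = {- real N - 1..real N + 1}" by auto
    ultimately show ?case by (simp only: I_Suc)
  qed
  have "(\<lambda>N. LINT x|lborel. indicator {- real N..real N} x *\<^sub>R \<psi> x) \<longlonglongrightarrow> (LINT x|lborel. \<psi> x)"
  proof (rule integral_dominated_convergence[where w="\<lambda>x. norm (\<psi> x)"])
    show "AE x in lborel. (\<lambda>N. indicator {- real N..real N} x *\<^sub>R \<psi> x) \<longlonglongrightarrow> \<psi> x"
    proof (intro AE_I2 tendsto_eventually)
      fix x :: real
      show "\<forall>\<^sub>F N in sequentially. indicator {- real N..real N} x *\<^sub>R \<psi> x = \<psi> x"
        using eventually_ge_at_top[of "nat \<lceil>\<bar>x\<bar>\<rceil>"]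
      proof eventually_elim
        case (elim N)
        then have "\<bar>x\<bar> \<le> real N" by linarith
        then show ?case by (auto simp: abs_le_iff)
      qed
    qed
  qed (use int in \<open>auto intro!: AE_I2 simp: indicator_def\<close>)
  moreover have "(LINT x|lborel. indicator {- real N..real N} x *\<^sub>R \<psi> x) = I {- int N..<int N}" for N
  proof -
    have "set_integrable lborel {- real N..real N} \<psi>"
      unfolding set_integrable_def using int by (intro integrable_mult_indicator) auto
    from set_borel_integral_eq_integral(2)[OF this] show ?thesis
      using IN[of N] by (simp add: set_lebesgue_integral_def integral_unique)
  qed
  ultimately have "J = (LINT x|lborel. \<psi> x)" using lim1 LIMSEQ_unique by simp
  then show ?thesis using J by simp
qed

text \<open>A rescaling of the characteristic function of the standard normal distribution.\<close>

lemma gauss_fourier: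
  fixes a t :: real
  assumes "a > 0"
  shows "integrable lborel (\<lambda>x. of_real (exp (- pi * a * x\<^sup>2)) * cis (2 * pi * t * x))"
    and "(LINT x|lborel. of_real (exp (- pi * a * x\<^sup>2)) * cis (2 * pi * t * x))
       = of_real (exp (- pi * t\<^sup>2 / a) / sqrt a)"
proof -
  \<comment> \<open>With c^2 = 2 pi a the standard normal density at c x is a constant multiple of
    exp(-pi a x^2).\<close>
  define c where "c = sqrt (2 * pi * a)"
  have c: "c > 0" "c\<^sup>2 = 2 * pi * a" using assms by (auto simp: c_def)
  define s where "s = 2 * pi * t / c"
  define h where "h x = std_normal_density x *\<^sub>R iexp (s * x)" for x
  have hI: "integrable lborel h"
  proof -
    have "integrable lborel std_normal_density" by (rule integrable_normal_density) simp
    then show ?thesis unfolding h_def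
      by (rule Bochner_Integration.integrable_bound) (auto simp: norm_mult)
  qed
  have "(LINT x|lborel. h x) = char std_normal_distribution s"
    unfolding char_def h_def by (subst integral_density) auto
  then have hv: "(LINT x|lborel. h x) = of_real (exp (- s\<^sup>2 / 2))"
    by (simp add: char_std_normal_distribution)
  have hc: "h (0 + c * x) = of_real (1 / sqrt (2 * pi)) * (of_real (exp (- pi * a * x\<^sup>2)) * cis (2 * pi * t * x))" for x
    using c by (simp add: h_def std_normal_density_def power_mult_distrib scaleR_conv_of_real s_def cis_conv_exp mult.assoc flip: exp_of_real)
  have sq: "sqrt (2 * pi) > 0" by simp
  have "integrable lborel (\<lambda>x. h (0 + c * x))"
    using lborel_integrable_real_affine[OF hI, of c 0] c by simp
  then have "integrable lborel (\<lambda>x. of_real (sqrt (2 * pi)) * h (0 + c * x))" by (rule integrable_mult_right)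
  then show "integrable lborel (\<lambda>x. of_real (exp (- pi * a * x\<^sup>2)) * cis (2 * pi * t * x))"
    unfolding hc by simp
  have "of_real (exp (- s\<^sup>2 / 2)) = \<bar>c\<bar> *\<^sub>R (LINT x|lborel. h (0 + c * x))"
    using lborel_integral_real_affine[of c h 0] c hv by simp
  also have "\<dots> = of_real (c / sqrt (2 * pi)) * (LINT x|lborel. of_real (exp (- pi * a * x\<^sup>2)) * cis (2 * pi * t * x))"
    unfolding hc using c by (simp add: scaleR_conv_of_real)
  also have "c / sqrt (2 * pi) = sqrt a" by (simp add: c_def real_sqrt_mult)
  finally have "(LINT x|lborel. of_real (exp (- pi * a * x\<^sup>2)) * cis (2 * pi * t * x)) = of_real (exp (- s\<^sup>2 / 2)) / of_real (sqrt a)"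
    using assms by (simp add: field_simps)
  also have "s\<^sup>2 = 2 * pi * t\<^sup>2 / a"
    unfolding s_def power_divide c power_mult_distrib using assms by (simp add: power2_eq_square)
  finally show "(LINT x|lborel. of_real (exp (- pi * a * x\<^sup>2)) * cis (2 * pi * t * x))
       = of_real (exp (- pi * t\<^sup>2 / a) / sqrt a)" by simp
qed

text \<open>Both sides are continuous and of period 1 in \<open>x\<close>, so it suffices to compare
  their Fourier coefficients.\<close>

lemma poisson_gauss_real:
  fixes a x y :: real
  assumes "a > 0"
  shows "(\<Sum>\<^sub>\<infinity>n::int. of_real (exp (- pi * a * (of_int n + x)\<^sup>2)) * cis (2 * pi * y * (of_int n + x)))
       = of_real (1 / sqrt a) * (\<Sum>\<^sub>\<infinity>m::int. of_real (exp (- pi * (of_int m - y)\<^sup>2 / a)) * cis (2 * pi * of_int m * x))"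
proof -
  define \<phi> where "\<phi> x = of_real (exp (- pi * a * x\<^sup>2)) * cis (2 * pi * y * x)" for x
  define F where "F x = (\<Sum>\<^sub>\<infinity>n::int. \<phi> (of_int n + x))" for x
  define c where "c m = complex_of_real (1 / sqrt a * exp (- pi * (of_int m - y)\<^sup>2 / a))" for m :: int
  define R where "R x = (\<Sum>\<^sub>\<infinity>m::int. c m * cis (2 * pi * of_int m * x))" for x
  have MF: "norm (\<phi> (of_int n + x)) \<le> exp (pi * a * X\<^sup>2) * exp (- (pi * a / 2) * \<bar>of_int n\<bar>)" if "\<bar>x\<bar> \<le> X" for n x X
    using exp_gauss_bound[of a a x X n] that assms by (simp add: \<phi>_def norm_mult)
  have sF: "(\<lambda>n::int. exp (pi * a * X\<^sup>2) * exp (- (pi * a / 2) * \<bar>of_int n\<bar>)) summable_on UNIV" for X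
    using assms by (intro summable_on_cmult_right summable_on_exp_abs_int) auto
  have MR: "norm (c m * cis (2 * pi * of_int m * x)) \<le> 1 / sqrt a * (exp (pi * (1/a) * y\<^sup>2) * exp (- (pi * (1/a) / 2) * \<bar>of_int m\<bar>))" for m x
    using exp_gauss_bound[of "1/a" "1/a" "-y" "\<bar>y\<bar>" m] assms by (simp add: c_def norm_mult norm_divide divide_right_mono)
  have sR: "(\<lambda>m::int. 1 / sqrt a * (exp (pi * (1/a) * y\<^sup>2) * exp (- (pi * (1/a) / 2) * \<bar>of_int m\<bar>))) summable_on UNIV"
    using assms by (intro summable_on_cmult_right summable_on_exp_abs_int) auto
  have cont\<phi>: "continuous_on UNIV \<phi>"
    unfolding \<phi>_def by (intro continuous_intros)
  have c1: "continuous_on S (\<lambda>x. \<phi> (of_int n + x))" for n :: int and S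
    by (rule continuous_on_compose2[OF cont\<phi>]) (auto intro!: continuous_intros)
  have contF: "continuous_on UNIV F"
  proof -
    have "isCont F x" for x
    proof -
      have "uniform_limit {-\<bar>x\<bar>-1..\<bar>x\<bar>+1} (\<lambda>X x. \<Sum>n\<in>X. \<phi> (of_int n + x)) F (finite_subsets_at_top UNIV)"
        unfolding F_def by (rule Weierstrass_m_test_general[OF MF[of _ "\<bar>x\<bar>+1"] sF[of "\<bar>x\<bar>+1"]]) auto
      then have "continuous_on {-\<bar>x\<bar>-1..\<bar>x\<bar>+1} F"
        by (rule uniform_limit_theorem[rotated]) (auto intro!: always_eventually continuous_intros c1)
      then show ?thesis by (rule continuous_on_interior) (auto simp: interior_atLeastAtMost_real abs_if)
    qed
    then show ?thesis by (simp add: continuous_on_eq_continuous_at)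
  qed
  have ulR: "uniform_limit S (\<lambda>X x. \<Sum>m\<in>X. c m * cis (2 * pi * of_int m * x)) R (finite_subsets_at_top UNIV)" for S
    unfolding R_def by (rule Weierstrass_m_test_general[OF MR sR])
  have contR: "continuous_on UNIV R"
    by (rule uniform_limit_theorem[OF _ ulR]) (auto intro!: always_eventually continuous_intros)
  have intcis: "((\<lambda>x. cis (2 * pi * of_int m * x)) has_integral (if m = 0 then 1 else 0)) {0..1}" for m :: int
  proof (cases "m = 0")
    case True
    then show ?thesis using has_integral_const_real[of "1::complex" 0 1] by simp
  next
    case False
    have "((\<lambda>x. cis (2 * pi * of_int m * x) / (2 * pi * of_int m * \<i>)) has_vector_derivative cis (2 * pi * of_int m * x)) (at x within {0..1})" for x
    proof -
      have "((\<lambda>z. exp (2 * pi * of_int m * \<i> * z) / (2 * pi * of_int m * \<i>)) has_field_derivative exp (2 * pi * of_int m * \<i> * of_real x)) (at (of_real x))"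
        using False by (auto intro!: derivative_eq_intros)
      from has_vector_derivative_real_field[OF this] show ?thesis
        by (simp add: cis_conv_exp mult_ac)
    qed
    then have "((\<lambda>x. cis (2 * pi * of_int m * x)) has_integral cis (2 * pi * of_int m * 1) / (2 * pi * of_int m * \<i>) - cis (2 * pi * of_int m * 0) / (2 * pi * of_int m * \<i>)) {0..1}"
      by (intro fundamental_theorem_of_calculus) auto
    moreover have "cis (2 * pi * of_int m) = 1" by (metis cis_multiple_2pi Ints_of_int)
    ultimately show ?thesis using False by simp
  qed
  have "F x - R x = 0"
  proof (rule fourier_coeffs_zero_imp_zero[of "\<lambda>x. F x - R x"])
    show "continuous_on UNIV (\<lambda>x. F x - R x)" by (intro continuous_intros contF contR)
    have "F (x + 1) = F x" for x
    proof -
      have "F (x + 1) = (\<Sum>\<^sub>\<infinity>n::int. \<phi> (of_int (n + 1) + x))" unfolding F_def by (simp add: algebra_simps)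
      also have "\<dots> = F x" unfolding F_def
        by (rule infsum_reindex_bij_witness[of _ "\<lambda>n. n - 1" "\<lambda>n. n + 1"]) auto
      finally show ?thesis .
    qed
    moreover have "cis (2 * pi * of_int m * (x + 1)) = cis (2 * pi * of_int m * x)" for m :: int and x
      by (simp add: distrib_left cis_mult[symmetric])
    then have "R (x + 1) = R x" for x unfolding R_def by simp
    ultimately show "F (x + 1) - R (x + 1) = F x - R x" for x by simp
  next
    fix k :: int
    \<comment> \<open>A character of period 1 passes through the periodization, so the coefficient
      of \<open>F\<close> is the integral of a modulated Gaussian over the whole line.\<close>
    define \<psi> where "\<psi> x = \<phi> x * cis (2 * pi * of_int k * x)" for x
    have \<psi>_eq: "\<psi> x = of_real (exp (- pi * a * x\<^sup>2)) * cis (2 * pi * (y + of_int k) * x)" for x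
      by (simp add: \<psi>_def \<phi>_def cis_mult algebra_simps flip: cis_mult)
    have cis1: "cis (2 * pi * of_int k * (of_int n + x)) = cis (2 * pi * of_int k * x)" for n :: int and x
      using cis_multiple_2pi[of "of_int (k * n)"] by (simp add: distrib_left mult.assoc flip: cis_mult)
    have "((\<lambda>x. \<Sum>\<^sub>\<infinity>n::int. \<psi> (of_int n + x)) has_integral (LINT x|lborel. \<psi> x)) {0..1}"
    proof (rule has_integral_periodization)
      show "continuous_on UNIV \<psi>" unfolding \<psi>_def by (intro continuous_intros cont\<phi>)
      show "integrable lborel \<psi>" using gauss_fourier(1)[OF assms, of "y + of_int k"] by (simp add: \<psi>_eq[abs_def])
      show "norm (\<psi> (of_int n + x)) \<le> exp (pi * a * 1\<^sup>2) * exp (- (pi * a / 2) * \<bar>of_int n\<bar>)" if "x \<in> {0..1}" for n x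
        using MF[of x 1 n] that by (simp add: \<psi>_def norm_mult)
    qed (rule sF)
    moreover have "(\<Sum>\<^sub>\<infinity>n::int. \<psi> (of_int n + x)) = F x * cis (2 * pi * of_int k * x)" for x
      unfolding F_def \<psi>_def cis1 by (rule infsum_cmult_left')
    moreover have "(LINT x|lborel. \<psi> x) = c (- k)"
      unfolding \<psi>_eq gauss_fourier(2)[OF assms] c_def by (simp add: power2_eq_square algebra_simps)
    ultimately have iF: "((\<lambda>x. F x * cis (2 * pi * of_int k * x)) has_integral c (- k)) {0..1}" by simp
    \<comment> \<open>\<open>R\<close> converges uniformly and may be integrated termwise;
      orthogonality of characters leaves only the term m = -k.\<close>
    have "uniform_limit {0..1} (\<lambda>X x. (\<Sum>m\<in>X. c m * cis (2 * pi * of_int m * x)) * cis (2 * pi * of_int k * x))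
         (\<lambda>x. R x * cis (2 * pi * of_int k * x)) (finite_subsets_at_top UNIV)"
    proof (rule uniform_limitI)
      fix e :: real assume "e > 0"
      from uniform_limitD[OF ulR[of "{0..1}"] this]
      show "\<forall>\<^sub>F X in finite_subsets_at_top UNIV. \<forall>x\<in>{0..1}. dist ((\<Sum>m\<in>X. c m * cis (2 * pi * of_int m * x)) * cis (2 * pi * of_int k * x)) (R x * cis (2 * pi * of_int k * x)) < e"
        by (simp add: dist_norm left_diff_distrib[symmetric] norm_mult)
    qed
    then obtain I J where I: "\<And>X. ((\<lambda>x. (\<Sum>m\<in>X. c m * cis (2 * pi * of_int m * x)) * cis (2 * pi * of_int k * x)) has_integral I X) {0..1}"
      and J: "((\<lambda>x. R x * cis (2 * pi * of_int k * x)) has_integral J) {0..1}"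
      and IJ: "(I \<longlongrightarrow> J) (finite_subsets_at_top UNIV)"
      by (rule uniform_limit_integral) (auto intro!: continuous_intros)
    have "I X = (\<Sum>m\<in>X. c m * (if m + k = 0 then 1 else 0))" if "finite X" for X
    proof -
      have "((\<lambda>x. \<Sum>m\<in>X. c m * cis (2 * pi * of_int (m + k) * x)) has_integral (\<Sum>m\<in>X. c m * (if m + k = 0 then 1 else 0))) {0..1}"
        by (intro has_integral_sum that has_integral_mult_right intcis)
      moreover have "(\<Sum>m\<in>X. c m * cis (2 * pi * of_int (m + k) * x)) = (\<Sum>m\<in>X. c m * cis (2 * pi * of_int m * x)) * cis (2 * pi * of_int k * x)" for x
        unfolding sum_distrib_right by (intro sum.cong refl) (simp add: distrib_left distrib_right mult.assoc flip: cis_mult)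
      ultimately show ?thesis using I[of X] has_integral_unique by simp
    qed
    then have "\<forall>\<^sub>F X in finite_subsets_at_top UNIV. I X = (\<Sum>m\<in>X. c m * (if m + k = 0 then 1 else 0))"
      by (intro eventually_finite_subsets_at_top_weakI) auto
    with IJ have "((\<lambda>m. c m * (if m + k = 0 then 1 else 0)) has_sum J) UNIV"
      unfolding has_sum_def using tendsto_cong by fastforce
    moreover have "((\<lambda>m. c m * (if m + k = 0 then 1 else 0)) has_sum c (- k)) UNIV"
      by (rule has_sum_finite_neutralI[of "{- k}"]) auto
    ultimately have "J = c (- k)" by (rule has_sum_unique)
    with has_integral_diff[OF iF J]
    show "((\<lambda>x. (F x - R x) * cis (2 * pi * of_int k * x)) has_integral 0) {0..1}" by (simp add: algebra_simps)
  qed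
  moreover have "R x = of_real (1 / sqrt a) * (\<Sum>\<^sub>\<infinity>m::int. of_real (exp (- pi * (of_int m - y)\<^sup>2 / a)) * cis (2 * pi * of_int m * x))"
    unfolding R_def c_def of_real_mult mult.assoc by (rule infsum_cmult_right')
  ultimately show ?thesis by (simp add: F_def \<phi>_def)
qed

section \<open>Gaussians with a complex parameter\<close>

text \<open>For \<gamma> = -i s this is the theta term exp(pi i s x^2); the condition Re \<gamma> >
  0 says that s lies in the upper half plane.\<close>

definition gauss_exp :: "complex \<Rightarrow> real \<Rightarrow> complex" where
  "gauss_exp \<gamma> x = exp (- (of_real pi * \<gamma> * (of_real x)\<^sup>2))"

lemma norm_gauss_exp: "norm (gauss_exp \<gamma> x) = exp (- pi * Re \<gamma> * x\<^sup>2)"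
  by (simp add: gauss_exp_def flip: of_real_power)

lemma gauss_exp_scale: "gauss_exp \<gamma> (c * x) = gauss_exp (\<gamma> * (of_real c)\<^sup>2) x"
  by (simp add: gauss_exp_def power_mult_distrib mult_ac)

lemma gauss_exp_minus [simp]: "gauss_exp \<gamma> (- x) = gauss_exp \<gamma> x"
  by (simp add: gauss_exp_def)

lemma gauss_exp_0 [simp]: "gauss_exp \<gamma> 0 = 1"
  by (simp add: gauss_exp_def)

lemma cnj_gauss_exp: "cnj (gauss_exp \<gamma> x) = gauss_exp (cnj \<gamma>) x"
  by (simp add: gauss_exp_def exp_cnj)

lemma norm_gauss_exp_bound:
  fixes n :: int
  assumes "Re \<gamma> \<ge> c" "c \<ge> 0" "\<bar>x\<bar> \<le> X"
  shows "norm (gauss_exp \<gamma> (of_int n + x)) \<le> exp (pi * c * X\<^sup>2) * exp (- (pi * c / 2) * \<bar>of_int n\<bar>)"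
  using exp_gauss_bound[OF assms, of n] by (simp add: norm_gauss_exp)

lemma abs_summable_gauss:
  assumes "Re \<gamma> > 0" "\<And>n::int. norm (w n) \<le> B"
  shows "(\<lambda>n::int. norm (w n * gauss_exp \<gamma> (of_int n + x))) summable_on UNIV"
proof (rule summable_on_comparison_test)
  show "(\<lambda>n::int. B * (exp (pi * Re \<gamma> * \<bar>x\<bar>\<^sup>2) * exp (- (pi * Re \<gamma> / 2) * \<bar>of_int n\<bar>))) summable_on UNIV"
    using assms by (intro summable_on_cmult_right summable_on_exp_abs_int) auto
  have "0 \<le> B" using assms(2)[of 0] norm_ge_zero order_trans by blast
  then show "norm (w n * gauss_exp \<gamma> (of_int n + x)) \<le> B * (exp (pi * Re \<gamma> * \<bar>x\<bar>\<^sup>2) * exp (- (pi * Re \<gamma> / 2) * \<bar>of_int n\<bar>))" for n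
    unfolding norm_mult using assms by (intro mult_mono norm_gauss_exp_bound) auto
qed auto

lemma holomorphic_gauss_sum:
  assumes c: "\<And>n::int. norm (c n) \<le> 1"
  shows "(\<lambda>\<gamma>. \<Sum>\<^sub>\<infinity>n::int. c n * gauss_exp \<gamma> (of_int n + x)) holomorphic_on {\<gamma>. Re \<gamma> > 0}"
    (is "?G holomorphic_on _")
proof -
  have "?G field_differentiable at z" if z: "Re z > 0" for z
  proof -
    \<comment> \<open>This radius keeps Re \<gamma> >= r > 0 on the closed disc, so one dominating
      series serves the whole disc.\<close>
    define r where "r = Re z / 2"
    have r: "r > 0" using z by (simp add: r_def)
    have Re_ge: "Re \<gamma> \<ge> r" if "\<gamma> \<in> cball z r" for \<gamma>
    proof -
      have "\<bar>Re (z - \<gamma>)\<bar> \<le> r" using that abs_Re_le_cmod[of "z - \<gamma>"] by (simp add: dist_norm)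
      then show ?thesis unfolding r_def minus_complex.simps by linarith
    qed
    have ul: "uniform_limit (cball z r) (\<lambda>X \<gamma>. \<Sum>n\<in>X. c n * gauss_exp \<gamma> (of_int n + x)) ?G (finite_subsets_at_top UNIV)"
    proof (rule Weierstrass_m_test_general)
      show "(\<lambda>n::int. 1 * (exp (pi * r * \<bar>x\<bar>\<^sup>2) * exp (- (pi * r / 2) * \<bar>of_int n\<bar>))) summable_on UNIV"
        using r by (intro summable_on_cmult_right summable_on_exp_abs_int) auto
      show "norm (c n * gauss_exp \<gamma> (of_int n + x)) \<le> 1 * (exp (pi * r * \<bar>x\<bar>\<^sup>2) * exp (- (pi * r / 2) * \<bar>of_int n\<bar>))"
        if "\<gamma> \<in> cball z r" for n \<gamma>
        unfolding norm_mult using r Re_ge[OF that] c by (intro mult_mono norm_gauss_exp_bound) auto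
    qed
    have hol: "(\<lambda>\<gamma>. \<Sum>n\<in>X. c n * gauss_exp \<gamma> (of_int n + x)) holomorphic_on S" for X S
      unfolding gauss_exp_def by (intro holomorphic_intros)
    obtain "continuous_on (cball z r) ?G" "?G holomorphic_on ball z r"
      by (rule holomorphic_uniform_limit[OF _ ul]) (auto intro!: always_eventually hol holomorphic_on_imp_continuous_on)
    then show ?thesis using r holomorphic_on_imp_differentiable_at by auto
  qed
  then show ?thesis by (auto simp: holomorphic_on_def intro: field_differentiable_at_within)
qed

text \<open>Analytic continuation of \<open>poisson_gauss_real\<close> from the positive reals to
  the right half plane, where the principal root \<open>csqrt\<close> is holomorphic.\<close>

lemma poisson_gauss:
  assumes "Re \<gamma> > 0"
  shows "(\<Sum>\<^sub>\<infinity>n::int. cis (2 * pi * y * (of_int n + x)) * gauss_exp \<gamma> (of_int n + x))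
       = 1 / csqrt \<gamma> * (\<Sum>\<^sub>\<infinity>m::int. cis (2 * pi * of_int m * x) * gauss_exp (1 / \<gamma>) (of_int m - y))"
proof -
  define S where "S = {\<gamma>. Re \<gamma> > 0}"
  define f where "f \<gamma> = (\<Sum>\<^sub>\<infinity>n::int. cis (2 * pi * y * (of_int n + x)) * gauss_exp \<gamma> (of_int n + x))" for \<gamma>
  define g where "g \<gamma> = (\<Sum>\<^sub>\<infinity>m::int. cis (2 * pi * of_int m * x) * gauss_exp \<gamma> (of_int m + - y))" for \<gamma>
  have hf: "f holomorphic_on S" and hg: "g holomorphic_on S"
    unfolding f_def g_def S_def by (rule holomorphic_gauss_sum; simp)+
  have inv: "1 / \<gamma> \<in> S" if "\<gamma> \<in> S" for \<gamma>
  proof -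
    have "\<gamma> \<noteq> 0" using that by (auto simp: S_def)
    then show ?thesis using that by (simp add: S_def Re_divide sum_power2_gt_zero_iff complex_eq_iff)
  qed
  have ne: "\<gamma> \<notin> \<real>\<^sub>\<le>\<^sub>0" "\<gamma> \<noteq> 0" "csqrt \<gamma> \<noteq> 0" if "\<gamma> \<in> S" for \<gamma>
    using that by (auto simp: S_def complex_nonpos_Reals_iff)
  have "(\<lambda>\<gamma>. g (1 / \<gamma>)) holomorphic_on S"
    using ne inv by (intro holomorphic_on_compose_gen[OF _ hg, unfolded o_def] holomorphic_intros) auto
  then have hol: "(\<lambda>\<gamma>. f \<gamma> - 1 / csqrt \<gamma> * g (1 / \<gamma>)) holomorphic_on S"
    using ne by (intro holomorphic_intros hf) auto
  have "f \<gamma> - 1 / csqrt \<gamma> * g (1 / \<gamma>) = 0"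
  proof (rule analytic_continuation[OF hol, of "of_real ` {0<..}" 1])
    show "open S" unfolding S_def by (rule open_halfspace_Re_gt)
    show "connected S" unfolding S_def by (intro convex_connected convex_halfspace_Re_gt)
    show "(1::complex) islimpt of_real ` {0<..}"
      unfolding islimpt_approachable
    proof (intro allI impI)
      fix e :: real assume "e > 0"
      then show "\<exists>x'\<in>complex_of_real ` {0<..}. x' \<noteq> 1 \<and> dist x' 1 < e"
        by (intro bexI[of _ "complex_of_real (1 + e / 2)"]) (auto simp: dist_norm complex_eq_iff)
    qed
    show "f z - 1 / csqrt z * g (1 / z) = 0" if z: "z \<in> complex_of_real ` {0<..}" for z
    proof -
      obtain a where a: "z = of_real a" "a > 0" using z by auto
      have e: "gauss_exp (of_real c) t = of_real (exp (- pi * c * t\<^sup>2))" for c t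
        by (simp add: gauss_exp_def flip: exp_of_real)
      have "f z = of_real (1 / sqrt a) * g (of_real (1 / a))"
        using poisson_gauss_real[OF a(2), of x y] unfolding f_def g_def a e by (simp add: mult.commute)
      then show ?thesis using a by (simp add: csqrt_of_real_nonneg)
    qed
    show "\<gamma> \<in> S" "(1::complex) \<in> S" "complex_of_real ` {0<..} \<subseteq> S" using assms by (auto simp: S_def)
  qed
  then show ?thesis by (simp add: f_def g_def)
qed

section \<open>Residue classes and periodic weights\<close>

lemma infsum_int_residues:
  fixes f :: "int \<Rightarrow> complex"
  assumes "f summable_on UNIV" "P > 0"
  shows "infsum f UNIV = (\<Sum>s\<in>{0..<P}. \<Sum>\<^sub>\<infinity>j. f (s + P * j))"
proof -
  have "(\<Sum>s\<in>{0..<P}. infsum f {t. t mod P = s}) = infsum f (\<Union>s\<in>{0..<P}. {t. t mod P = s})"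
    by (rule sum_infsum) (auto intro: summable_on_subset_banach[OF assms(1)])
  also have "(\<Union>s\<in>{0..<P}. {t. t mod P = s}) = UNIV" using assms(2) by auto
  finally have "infsum f UNIV = (\<Sum>s\<in>{0..<P}. infsum f {t. t mod P = s})" ..
  also have "\<dots> = (\<Sum>s\<in>{0..<P}. \<Sum>\<^sub>\<infinity>j. f (s + P * j))"
  proof (rule sum.cong[OF refl])
    fix s assume "s \<in> {0..<P}"
    then show "infsum f {t. t mod P = s} = (\<Sum>\<^sub>\<infinity>j. f (s + P * j))"
      using assms(2) by (intro infsum_reindex_bij_witness[of _ "\<lambda>j. s + P * j" "\<lambda>t. t div P"])
        (auto simp: mult_div_mod_eq)
  qed
  finally show ?thesis .
qed

lemma infsum_sum_finite:
  fixes f :: "'a \<Rightarrow> 'b \<Rightarrow> complex"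
  assumes "finite A" "\<And>s. s \<in> A \<Longrightarrow> f s summable_on X"
  shows "(\<Sum>\<^sub>\<infinity>m\<in>X. \<Sum>s\<in>A. f s m) = (\<Sum>s\<in>A. \<Sum>\<^sub>\<infinity>m\<in>X. f s m)"
proof -
  have "((\<lambda>m. \<Sum>s\<in>A. f s m) has_sum (\<Sum>s\<in>A. \<Sum>\<^sub>\<infinity>m\<in>X. f s m)) X"
    using assms by (induction A rule: finite_induct) (auto intro!: has_sum_add)
  then show ?thesis by (rule infsumI)
qed

lemma periodic_mult:
  fixes w :: "int \<Rightarrow> 'a"
  assumes "\<And>t. w (t + P) = w t"
  shows "w (t + P * j) = w t"
proof (induction j rule: int_induct[where k=0])
  case (step1 i)
  then show ?case using assms[of "t + P * i"] by (simp add: algebra_simps)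
next
  case (step2 i)
  then show ?case using assms[of "t + P * (i - 1)"] by (simp add: algebra_simps)
qed simp

lemma periodic_bounded:
  fixes w :: "int \<Rightarrow> complex"
  assumes "P > 0" "\<And>t. w (t + P) = w t"
  obtains B where "\<And>t. norm (w t) \<le> B"
proof
  fix t
  have "w t = w (t mod P)" using periodic_mult[of w P, OF assms(2), of "t mod P" "t div P"] by simp
  moreover have "norm (w (t mod P)) \<le> (\<Sum>s\<in>{0..<P}. norm (w s))"
    using assms(1) by (intro member_le_sum) auto
  ultimately show "norm (w t) \<le> (\<Sum>s\<in>{0..<P}. norm (w s))" by simp
qed

text \<open>On the class of s modulo P, writing t = P(j + s/P) leads to \<open>poisson_gauss\<close>
  with x = s/P and parameter \<gamma> P^2. Summing over s collects the finite Fourier transform of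
  the weight.\<close>

lemma poisson_gauss_weighted:
  fixes w :: "int \<Rightarrow> complex" and P :: int and y :: real
  assumes "Re \<gamma> > 0" "P > 0" "\<And>t. w (t + P) = w t"
  shows "(\<Sum>\<^sub>\<infinity>t. w t * cis (2 * pi * y * of_int t) * gauss_exp \<gamma> (of_int t))
       = 1 / csqrt (\<gamma> * (of_int P)\<^sup>2) *
         (\<Sum>\<^sub>\<infinity>m. (\<Sum>s\<in>{0..<P}. w s * cis (2 * pi * of_int m * of_int s / of_int P)) *
                gauss_exp (1 / (\<gamma> * (of_int P)\<^sup>2)) (of_int m - y * of_int P))"
proof -
  obtain B where B: "\<And>t. norm (w t) \<le> B" using periodic_bounded[of P w, OF assms(2,3)] by blast
  define \<Gamma> where "\<Gamma> = \<gamma> * (of_int P)\<^sup>2"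
  have "Re \<Gamma> = Re \<gamma> * (of_int P)\<^sup>2" unfolding \<Gamma>_def by (simp flip: of_int_power)
  then have \<Gamma>: "Re \<Gamma> > 0" using assms(1,2) by simp
  have \<Gamma>i: "Re (1 / \<Gamma>) > 0"
  proof -
    have "\<Gamma> \<noteq> 0" using \<Gamma> by auto
    then show ?thesis using \<Gamma> by (simp add: Re_divide sum_power2_gt_zero_iff complex_eq_iff)
  qed
  have sm: "(\<lambda>m. v * cis (2 * pi * of_int m * x) * gauss_exp (1 / \<Gamma>) (of_int m - y')) summable_on UNIV" for v x y'
    by (rule abs_summable_summable) (use abs_summable_gauss[OF \<Gamma>i, of "\<lambda>m. v * cis (2 * pi * of_int m * x)" "norm v" "- y'"] in \<open>simp add: norm_mult\<close>)
  have "(\<lambda>t. w t * cis (2 * pi * y * of_int t) * gauss_exp \<gamma> (of_int t)) summable_on UNIV"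
    by (rule abs_summable_summable) (use abs_summable_gauss[OF assms(1), of "\<lambda>t. w t * cis (2 * pi * y * of_int t)" B 0] B in \<open>simp add: norm_mult\<close>)
  then have "(\<Sum>\<^sub>\<infinity>t. w t * cis (2 * pi * y * of_int t) * gauss_exp \<gamma> (of_int t))
     = (\<Sum>s\<in>{0..<P}. \<Sum>\<^sub>\<infinity>j. w (s + P * j) * cis (2 * pi * y * of_int (s + P * j)) * gauss_exp \<gamma> (of_int (s + P * j)))"
    using assms(2) by (rule infsum_int_residues)
  also have "\<dots> = (\<Sum>s\<in>{0..<P}. w s * (\<Sum>\<^sub>\<infinity>j::int. cis (2 * pi * (y * of_int P) * (of_int j + of_int s / of_int P)) * gauss_exp \<Gamma> (of_int j + of_int s / of_int P)))"
  proof (rule sum.cong[OF refl])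
    fix s assume "s \<in> {0..<P}"
    have "of_int (s + P * j) = real_of_int P * (of_int j + of_int s / of_int P)" for j
      using assms(2) by (simp add: field_simps)
    then have "w (s + P * j) * cis (2 * pi * y * of_int (s + P * j)) * gauss_exp \<gamma> (of_int (s + P * j))
        = w s * (cis (2 * pi * (y * of_int P) * (of_int j + of_int s / of_int P)) * gauss_exp \<Gamma> (of_int j + of_int s / of_int P))" for j
      using periodic_mult[of w P, OF assms(3), of s j] gauss_exp_scale[of \<gamma> "of_int P"] by (simp add: \<Gamma>_def mult.assoc)
    then show "(\<Sum>\<^sub>\<infinity>j. w (s + P * j) * cis (2 * pi * y * of_int (s + P * j)) * gauss_exp \<gamma> (of_int (s + P * j)))
       = w s * (\<Sum>\<^sub>\<infinity>j::int. cis (2 * pi * (y * of_int P) * (of_int j + of_int s / of_int P)) * gauss_exp \<Gamma> (of_int j + of_int s / of_int P))"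
      by (simp only: infsum_cmult_right')
  qed
  also have "\<dots> = (\<Sum>s\<in>{0..<P}. 1 / csqrt \<Gamma> * (\<Sum>\<^sub>\<infinity>m. w s * cis (2 * pi * of_int m * (of_int s / of_int P)) * gauss_exp (1 / \<Gamma>) (of_int m - y * of_int P)))"
    unfolding poisson_gauss[OF \<Gamma>] mult.assoc[of "w _"] infsum_cmult_right' by (simp add: mult_ac)
  also have "\<dots> = 1 / csqrt \<Gamma> * (\<Sum>\<^sub>\<infinity>m. \<Sum>s\<in>{0..<P}. w s * cis (2 * pi * of_int m * (of_int s / of_int P)) * gauss_exp (1 / \<Gamma>) (of_int m - y * of_int P))"
    unfolding sum_distrib_left[symmetric] by (subst infsum_sum_finite[OF finite_atLeastLessThan_int sm]) (rule refl)
  finally show ?thesis by (simp add: \<Gamma>_def sum_distrib_right)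
qed

lemma cis_cong_int:
  assumes "[a = b] (mod (2 * n))" "n \<noteq> 0"
  shows "cis (pi * of_int a / of_int n) = cis (pi * of_int b / of_int n)"
proof -
  obtain k where k: "a = b + 2 * n * k" using assms(1) by (metis cong_iff_lin cong_sym_eq mult.commute)
  have "pi * of_int a / of_int n = pi * of_int b / of_int n + 2 * pi * of_int k"
    using assms(2) by (simp add: k field_simps)
  then show ?thesis by (simp only: cis_mult[symmetric] cis_multiple_2pi[OF Ints_of_int]) simp
qed

text \<open>Doubling permutes the residues modulo an odd number. This is what trades k -> f(2k) for
  f in sums over the group.\<close>

lemma sum_periodic_double:
  fixes H :: "int \<Rightarrow> 'a::comm_monoid_add"
  assumes "odd d" "d > 0" "\<And>s. H (s + d) = H s"
  shows "(\<Sum>l\<in>{0..<d}. H (2 * l)) = (\<Sum>l\<in>{0..<d}. H l)"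
proof -
  have "inj_on (\<lambda>l. (2 * l) mod d) {0..<d}"
  proof (rule inj_onI)
    fix x y assume xy: "x \<in> {0..<d}" "y \<in> {0..<d}" "(2 * x) mod d = (2 * y) mod d"
    have "[2 * x = 2 * y] (mod d)" unfolding unique_euclidean_semiring_class.cong_def by (rule xy(3))
    moreover have "coprime 2 d" using assms(1) by simp
    ultimately have "[x = y] (mod d)" by (simp add: cong_mult_lcancel coprime_commute)
    then show "x = y" using xy(1,2) by (simp add: unique_euclidean_semiring_class.cong_def)
  qed
  moreover have "(\<lambda>l. (2 * l) mod d) ` {0..<d} \<subseteq> {0..<d}" using assms(2) by auto
  ultimately have "bij_betw (\<lambda>l. (2 * l) mod d) {0..<d} {0..<d}"
    by (simp add: bij_betw_def endo_inj_surj)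
  then have "(\<Sum>l\<in>{0..<d}. H ((2 * l) mod d)) = (\<Sum>l\<in>{0..<d}. H l)"
    by (rule sum.reindex_bij_betw)
  moreover have "H ((2 * l) mod d) = H (2 * l)" for l
    using periodic_mult[of H d, OF assms(3), of "(2 * l) mod d" "(2 * l) div d"] by simp
  ultimately show ?thesis by simp
qed

lemma sum_periodic_shift:
  fixes H :: "int \<Rightarrow> 'a::comm_monoid_add"
  assumes "\<And>s. H (s + P) = H s" "P > 0"
  shows "(\<Sum>s\<in>{0..<P}. H (s + m)) = (\<Sum>s\<in>{0..<P}. H s)"
proof -
  have "H (t mod P) = H t" for t
    using periodic_mult[of H P, OF assms(1), of "t mod P" "t div P"] by simp
  then have "(\<Sum>s\<in>{0..<P}. H (s + m)) = (\<Sum>s\<in>{0..<P}. H ((s + m) mod P))" by simp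
  also have "\<dots> = (\<Sum>s\<in>{0..<P}. H s)"
  proof (rule sum.reindex_bij_witness[of _ "\<lambda>s. (s - m) mod P" "\<lambda>s. (s + m) mod P"])
  qed (use assms(2) in \<open>auto simp: mod_simps\<close>)
  finally show ?thesis .
qed

subsection \<open>The critical theta function\<close>

text \<open>The intended instance is \<mu> = sqrt a + i sqrt b with N = a - b. There Im(\<mu>^2) = 2
  sqrt(ab) is at least 2, which serves the non-vanishing proof, and d^2 - 2N + 1 = (d+1)^2 - 4a, so
  \<open>dvd_16\<close> encodes the congruence on a.\<close>

locale critical_theta =
  fixes d :: nat and N :: int and \<mu> :: complex
  assumes odd_d: "odd d"
    and Re_\<mu>: "Re \<mu> > 0" and Im_\<mu>: "Im \<mu> > 0"
    and norm_\<mu>: "\<mu> * cnj \<mu> = of_nat d"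
    and Re_\<mu>2: "Re (\<mu>\<^sup>2) = of_int N" and Im_\<mu>2: "Im (\<mu>\<^sup>2) \<ge> 2"
    and dvd_16: "16 dvd (int d)\<^sup>2 - 2 * N + 1"
begin

lemma d_pos: "d > 0" using odd_d by (cases d) auto

lemma \<mu>_nonzero: "\<mu> \<noteq> 0" using Re_\<mu> by auto

definition \<beta> :: complex where "\<beta> = \<i> / (4 * \<mu>\<^sup>2)"

text \<open>Since |\<mu>|^2 = d, the inverse of \<mu>^2 is its conjugate over d^2. This brings the
  known real part N of \<mu>^2 into the numerator.\<close>

lemma \<beta>_eq: "\<beta> = \<i> * cnj (\<mu>\<^sup>2) / (4 * (of_nat d)\<^sup>2)"
  using \<mu>_nonzero by (simp add: \<beta>_def norm_\<mu>[symmetric] field_simps)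

lemma Re_\<beta>: "Re \<beta> = Im (\<mu>\<^sup>2) / (4 * (real d)\<^sup>2)"
proof -
  have "\<beta> = (\<i> * cnj (\<mu>\<^sup>2)) / of_real (4 * (real d)\<^sup>2)" by (simp add: \<beta>_eq)
  then show ?thesis by (simp only: Re_divide_of_real) (simp del: complex_cnj_power)
qed

lemma Re_\<beta>_pos: "Re \<beta> > 0"
  unfolding Re_\<beta> using Im_\<mu>2 d_pos by simp

text \<open>
  \<open>E m = exp(\<pi>\<i>\<sigma>m\<^sup>2)\<close> and \<open>E2 m = exp(\<pi>\<i>\<sigma>m\<^sup>2/2)\<close>, where \<open>\<pi>\<i>\<sigma> = \<pi>\<i>/4 - \<pi>\<beta>\<close>. The periodic factor is split off
  because Poisson summation acts on it as a finite Fourier transform.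
\<close>

definition E :: "int \<Rightarrow> complex" where
  "E m = cis (pi * of_int (m\<^sup>2) / of_int 4) * gauss_exp \<beta> (of_int m)"

definition E2 :: "int \<Rightarrow> complex" where
  "E2 m = cis (pi * of_int (m\<^sup>2) / of_int 8) * gauss_exp (\<beta> / 2) (of_int m)"

text \<open>The parallelogram identity for the exponents. It is used in both directions in the
  convolution.\<close>

lemma E_mult_E: "E m * E n = E2 (m + n) * E2 (m - n)"
proof -
  have "cis (pi * of_int (m\<^sup>2) / of_int 4) * cis (pi * of_int (n\<^sup>2) / of_int 4)
      = cis (pi * of_int ((m + n)\<^sup>2) / of_int 8) * cis (pi * of_int ((m - n)\<^sup>2) / of_int 8)"
    unfolding cis_mult by (rule arg_cong[where f=cis]) (simp add: power2_eq_square field_simps)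
  moreover have "gauss_exp \<beta> (of_int m) * gauss_exp \<beta> (of_int n) = gauss_exp (\<beta> / 2) (of_int (m + n)) * gauss_exp (\<beta> / 2) (of_int (m - n))"
    unfolding gauss_exp_def exp_add[symmetric] by (rule arg_cong[where f=exp]) (simp add: power2_eq_square field_simps)
  ultimately show ?thesis by (simp add: E_def E2_def mult_ac)
qed

lemma E_minus: "E (- m) = E m"
  by (simp add: E_def)

lemma norm_E: "norm (E m) = exp (- pi * Re \<beta> * (of_int m)\<^sup>2)"
  by (simp add: E_def norm_mult norm_gauss_exp)

lemma abs_summable_E: "(\<lambda>m. norm (E m)) summable_on UNIV"
  unfolding E_def using abs_summable_gauss[OF Re_\<beta>_pos, of "\<lambda>m. cis (pi * of_int (m\<^sup>2) / of_int 4)" 1 0] by simp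

lemma summable_E_inj: "inj \<phi> \<Longrightarrow> (\<lambda>j. E (\<phi> j)) summable_on UNIV"
  using summable_on_subset_banach[OF abs_summable_summable[OF abs_summable_E], of "range \<phi>"] summable_on_reindex[of \<phi> UNIV E]
  by (simp add: o_def)

definition f :: "int \<Rightarrow> complex" where
  "f k = (\<Sum>\<^sub>\<infinity>j. E (k + int d * j))"

lemma f_periodic: "f (k + int d) = f k"
  unfolding f_def
  by (rule infsum_reindex_bij_witness[of _ "\<lambda>j. j - 1" "\<lambda>j. j + 1"]) (auto simp: algebra_simps)

lemma f_minus: "f (- k) = f k"
  unfolding f_def
proof (rule infsum_reindex_bij_witness[of _ uminus uminus])
  fix j show "E (k + int d * - j) = E (- k + int d * j)"
    using E_minus[of "k - int d * j"] by (simp add: algebra_simps)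
qed auto

text \<open>The family of all products E(m) E(n) is absolutely summable over pairs, and an injective
  index map selects a subfamily. This justifies every exchange of double sums below.\<close>

lemma summable_E_pair:
  fixes \<phi> \<psi> :: "int \<times> int \<Rightarrow> int"
  assumes "inj (\<lambda>x. (\<phi> x, \<psi> x))"
  shows "(\<lambda>x. E (\<phi> x) * E (\<psi> x)) summable_on UNIV"
proof -
  have "(\<lambda>x. norm (E (fst x) * E (snd x))) summable_on UNIV \<times> UNIV"
    unfolding norm_mult case_prod_unfold[symmetric]
    by (rule summable_on_SigmaI) (auto intro!: abs_summable_E has_sum_cmult_right has_sum_infsum summable_on_cmult_left)
  then have "(\<lambda>x. E (fst x) * E (snd x)) summable_on UNIV" using abs_summable_summable by simp
  then have "(\<lambda>x. E (fst x) * E (snd x)) summable_on range (\<lambda>x. (\<phi> x, \<psi> x))"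
    by (rule summable_on_subset_banach) auto
  then show ?thesis using assms by (subst (asm) summable_on_reindex) (auto simp: o_def)
qed

section \<open>Quadratic Gauss sums modulo 4 and 8\<close>

text \<open>Completing the square: -s^2 + 2ms = m^2 - (s-m)^2. The square modulo 8 depends only on
  the residue modulo 4, so the shift by m does not affect the sum.\<close>

lemma gauss_sum_4:
  "(\<Sum>s\<in>{0..<4::int}. cis (- (pi * of_int (s\<^sup>2) / of_int 4)) * cis (2 * pi * of_int m * of_int s / of_int 4))
   = 2 * cis (- pi / 4) * cis (pi * of_int (m\<^sup>2) / of_int 4)"
proof -
  define H :: "int \<Rightarrow> complex" where "H r = cis (- (pi * of_int (r\<^sup>2) / of_int 4))" for r
  have Hp: "H (r + 4) = H r" for r
  proof -
    have "[(r + 4)\<^sup>2 = r\<^sup>2] (mod (2 * 4))" by (simp add: cong_iff_dvd_diff power2_eq_square algebra_simps)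
    from cis_cong_int[OF this] have "cnj (cis (pi * of_int ((r + 4)\<^sup>2) / of_int 4)) = cnj (cis (pi * of_int (r\<^sup>2) / of_int 4))" by simp
    then show ?thesis unfolding H_def cis_cnj by simp
  qed
  have "(\<Sum>s\<in>{0..<4::int}. cis (- (pi * of_int (s\<^sup>2) / of_int 4)) * cis (2 * pi * of_int m * of_int s / of_int 4))
     = (\<Sum>s\<in>{0..<4::int}. H (s - m)) * cis (pi * of_int (m\<^sup>2) / of_int 4)"
    unfolding sum_distrib_right H_def cis_mult
    by (intro sum.cong refl arg_cong[where f=cis]) (simp add: power2_eq_square field_simps)
  also have "(\<Sum>s\<in>{0..<4::int}. H (s - m)) = (\<Sum>s\<in>{0..<4::int}. H s)"
  proof -
    have "(\<Sum>s\<in>{0..<4::int}. H (s + - m)) = (\<Sum>s\<in>{0..<4::int}. H s)"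
      by (rule sum_periodic_shift) (auto intro: Hp)
    then show ?thesis by simp
  qed
  also have "\<dots> = 2 * cis (- pi / 4)"
  proof -
    have set: "{0..<4::int} = {0, 1, 2, 3}" by auto
    have "H 3 = H (-1)" using Hp[of "-1"] by simp
    moreover have "H (-1) = H 1" by (simp add: H_def)
    moreover have "H 2 = -1" by (simp add: H_def flip: cis_cnj)
    moreover have "H 0 = 1" "H 1 = cis (- pi / 4)" by (simp_all add: H_def)
    ultimately show ?thesis unfolding set by simp
  qed
  finally show ?thesis .
qed

text \<open>Again a completed square, s^2 + 2ms = (s+m)^2 - m^2. The sum over even s+m is 2 + 2i and
  the sum over odd s+m cancels, so the parity condition on s reappears as the same condition on
  m.\<close>

lemma gauss_sum_8:
  "(\<Sum>s\<in>{0..<8::int}. of_bool (even (s - J)) * cis (pi * of_int (s\<^sup>2) / of_int 8) * cis (2 * pi * of_int m * of_int s / of_int 8))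
   = of_bool (even (m - J)) * (2 + 2 * \<i>) * cis (- (pi * of_int (m\<^sup>2) / of_int 8))"
proof -
  define H :: "int \<Rightarrow> complex" where "H r = of_bool (even (r - m - J)) * cis (pi * of_int (r\<^sup>2) / of_int 8)" for r
  have Hp: "H (r + 8) = H r" for r
  proof -
    have "[(r + 8)\<^sup>2 = r\<^sup>2] (mod (2 * 8))" by (simp add: cong_iff_dvd_diff power2_eq_square algebra_simps)
    from cis_cong_int[OF this] show ?thesis unfolding H_def by simp
  qed
  have "(\<Sum>s\<in>{0..<8::int}. of_bool (even (s - J)) * cis (pi * of_int (s\<^sup>2) / of_int 8) * cis (2 * pi * of_int m * of_int s / of_int 8))
     = (\<Sum>s\<in>{0..<8::int}. H (s + m)) * cis (- (pi * of_int (m\<^sup>2) / of_int 8))"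
    unfolding sum_distrib_right H_def mult.assoc cis_mult
    by (intro sum.cong refl arg_cong2[where f="(*)"] arg_cong[where f=cis]) (simp_all add: power2_eq_square field_simps)
  also have "(\<Sum>s\<in>{0..<8::int}. H (s + m)) = (\<Sum>s\<in>{0..<8::int}. H s)"
    by (rule sum_periodic_shift) (auto intro: Hp)
  also have "\<dots> = of_bool (even (m - J)) * (2 + 2 * \<i>)"
  proof -
    have set: "{0..<8::int} = {0, 1, 2, 3, 4, 5, 6, 7}" by auto
    have c: "cis (pi * 9 / 8) = - cis (pi / 8)" 
    proof -
      have "pi * 9 / 8 = pi / 8 + pi" by simp
      then show ?thesis by (simp only: cis_mult[symmetric]) simp
    qed
    have "cis (pi * of_int 16 / of_int 8) = cis (pi * of_int 0 / of_int 8)" "cis (pi * of_int 36 / of_int 8) = cis (pi * of_int 4 / of_int 8)"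
      "cis (pi * of_int 25 / of_int 8) = cis (pi * of_int 9 / of_int 8)" "cis (pi * of_int 49 / of_int 8) = cis (pi * of_int 1 / of_int 8)"
      by (rule cis_cong_int; simp add: cong_iff_dvd_diff)+
    then have "H 4 = H 0" "H 6 = of_bool (even (m - J)) * \<i>" "H 2 = of_bool (even (m - J)) * \<i>" "H 0 = of_bool (even (m - J))"
      "H 1 = of_bool (odd (m - J)) * cis (pi / 8)" "H 3 = - H 1" "H 5 = - H 1" "H 7 = H 1"
      using c by (auto simp: H_def)
    then show ?thesis unfolding set by (simp add: algebra_simps)
  qed
  finally show ?thesis .
qed

section \<open>The theta transformation at the complex multiplication point\<close>

text \<open>Puts a sum over one parity class into the shape of a periodically weighted sum over all
  integers, as \<open>poisson_gauss_weighted\<close> expects.\<close>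

lemma infsum_parity:
  fixes g :: "int \<Rightarrow> complex"
  shows "(\<Sum>\<^sub>\<infinity>u. g (2 * u - J)) = (\<Sum>\<^sub>\<infinity>t. of_bool (even (t - J)) * g t)"
proof -
  have "(\<Sum>\<^sub>\<infinity>u. g (2 * u - J)) = (\<Sum>\<^sub>\<infinity>t\<in>{t. even (t - J)}. g t)"
  proof (rule infsum_reindex_bij_witness[of _ "\<lambda>t. (t + J) div 2" "\<lambda>u. 2 * u - J"])
  qed auto
  also have "\<dots> = (\<Sum>\<^sub>\<infinity>t. of_bool (even (t - J)) * g t)"
    by (rule infsum_cong_neutral) auto
  finally show ?thesis .
qed

text \<open>The square is 8i/\<mu>^2. Positivity of both parts of \<mu> selects this root, so that
  the factor of the transformation is \<mu> and not its negative.\<close>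

lemma csqrt_\<beta>: "csqrt (\<beta> / 2 * (of_int 8)\<^sup>2) = (2 + 2 * \<i>) / \<mu>"
proof (rule csqrt_unique)
  have "(2 + 2 * \<i>)\<^sup>2 = 8 * \<i>" by (simp add: power2_eq_square algebra_simps)
  then show "((2 + 2 * \<i>) / \<mu>)\<^sup>2 = \<beta> / 2 * (of_int 8)\<^sup>2"
    by (simp add: \<beta>_def power_divide)
  have "(2 + 2 * \<i>) / \<mu> = (2 + 2 * \<i>) * cnj \<mu> / of_real (real d)"
    using \<mu>_nonzero by (simp add: norm_\<mu>[symmetric])
  then have "Re ((2 + 2 * \<i>) / \<mu>) = Re ((2 + 2 * \<i>) * cnj \<mu>) / real d" by (simp only: Re_divide_of_real)
  also have "\<dots> > 0" using Re_\<mu> Im_\<mu> d_pos by simp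
  finally show "0 < Re ((2 + 2 * \<i>) / \<mu>) \<or> Re ((2 + 2 * \<i>) / \<mu>) = 0 \<and> 0 \<le> Im ((2 + 2 * \<i>) / \<mu>)" ..
qed

text \<open>Because \<mu>^2 + cnj(\<mu>^2) = 2N, the parameter d^2 \<beta>/2 and the dual parameter
  1/(32 \<beta>) = -i\<mu>^2/8 differ by 2iN/8, a pure phase. Together with the phase of
  \<open>E2\<close> the exponent is (d^2 - 2N) m^2, which \<open>dvd_16\<close> reduces to -m^2
  modulo 16.\<close>

lemma E2_scale:
  "E2 (int d * m) = cis (- (pi * of_int (m\<^sup>2) / of_int 8)) * gauss_exp (1 / (\<beta> / 2 * (of_int 8)\<^sup>2)) (of_int m)"
proof -
  have "\<mu>\<^sup>2 + cnj (\<mu>\<^sup>2) = 2 * of_int N" using Re_\<mu>2 complex_add_cnj[of "\<mu>\<^sup>2"] by simp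
  then have "cnj (\<mu>\<^sup>2) = 2 * of_int N - \<mu>\<^sup>2" by (simp add: algebra_simps)
  then have 1: "\<beta> / 2 * (of_real (real d))\<^sup>2 = \<i> * (2 * of_int N - \<mu>\<^sup>2) / 8"
    unfolding \<beta>_eq using d_pos by simp
  have 2: "1 / (\<beta> / 2 * (of_int 8)\<^sup>2) = - \<i> * \<mu>\<^sup>2 / 8"
    using \<mu>_nonzero by (simp add: \<beta>_def)
  have "gauss_exp (\<beta> / 2) (of_int (int d * m)) = gauss_exp (\<beta> / 2 * (of_real (real d))\<^sup>2) (of_int m)"
    using gauss_exp_scale[of "\<beta> / 2" "real d"] by simp
  also have "\<dots> = cis (pi * of_int (- 2 * N * m\<^sup>2) / of_int 8) * gauss_exp (1 / (\<beta> / 2 * (of_int 8)\<^sup>2)) (of_int m)"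
    unfolding 1 2 gauss_exp_def cis_conv_exp exp_add[symmetric]
    by (rule arg_cong[where f=exp]) (simp add: field_simps)
  finally have "E2 (int d * m) = (cis (pi * of_int ((int d * m)\<^sup>2) / of_int 8) * cis (pi * of_int (- 2 * N * m\<^sup>2) / of_int 8)) * gauss_exp (1 / (\<beta> / 2 * (of_int 8)\<^sup>2)) (of_int m)"
    unfolding E2_def by simp
  also have "cis (pi * of_int ((int d * m)\<^sup>2) / of_int 8) * cis (pi * of_int (- 2 * N * m\<^sup>2) / of_int 8)
     = cis (pi * of_int (((int d)\<^sup>2 - 2 * N) * m\<^sup>2) / of_int 8)"
    unfolding cis_mult by (rule arg_cong[where f=cis]) (simp add: field_simps)
  also have "\<dots> = cis (pi * of_int (- (m\<^sup>2)) / of_int 8)"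
  proof (rule cis_cong_int)
    have "16 dvd ((int d)\<^sup>2 - 2 * N + 1) * m\<^sup>2" using dvd_16 by (rule dvd_mult2)
    then show "[((int d)\<^sup>2 - 2 * N) * m\<^sup>2 = - (m\<^sup>2)] (mod (2 * 8))"
      by (simp add: cong_iff_dvd_diff algebra_simps)
  qed simp
  finally show ?thesis by simp
qed

text \<open>Poisson summation with a weight of period 8: \<open>gauss_sum_8\<close> and
  \<open>E2_scale\<close> identify the dual series, and the Gauss sum over the square root in
  \<open>csqrt_\<beta>\<close> leaves exactly \<mu>.\<close>

lemma E2_sum_scale: "(\<Sum>\<^sub>\<infinity>u. E2 (2 * u - J)) = \<mu> * (\<Sum>\<^sub>\<infinity>u. E2 (int d * (2 * u - J)))"
proof -
  define w :: "int \<Rightarrow> complex" where "w t = of_bool (even (t - J)) * cis (pi * of_int (t\<^sup>2) / of_int 8)" for t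
  have wp: "w (t + 8) = w t" for t
  proof -
    have "[(t + 8)\<^sup>2 = t\<^sup>2] (mod (2 * 8))" by (simp add: cong_iff_dvd_diff power2_eq_square algebra_simps)
    from cis_cong_int[OF this] show ?thesis unfolding w_def by simp
  qed
  have "(\<Sum>\<^sub>\<infinity>u. E2 (2 * u - J)) = (\<Sum>\<^sub>\<infinity>t. w t * cis (2 * pi * 0 * of_int t) * gauss_exp (\<beta> / 2) (of_int t))"
    unfolding infsum_parity[of E2] w_def by (simp add: E2_def mult.assoc)
  also have "\<dots> = 1 / csqrt (\<beta> / 2 * (of_int 8)\<^sup>2) *
         (\<Sum>\<^sub>\<infinity>m. (\<Sum>s\<in>{0..<8}. w s * cis (2 * pi * of_int m * of_int s / of_int 8)) *
                gauss_exp (1 / (\<beta> / 2 * (of_int 8)\<^sup>2)) (of_int m - 0 * of_int 8))"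
    by (rule poisson_gauss_weighted) (use Re_\<beta>_pos wp in auto)
  also have "\<dots> = 1 / csqrt (\<beta> / 2 * (of_int 8)\<^sup>2) * (\<Sum>\<^sub>\<infinity>m. (2 + 2 * \<i>) * (of_bool (even (m - J)) * E2 (int d * m)))"
    unfolding w_def gauss_sum_8 E2_scale by (simp add: mult_ac)
  also have "\<dots> = \<mu> * (\<Sum>\<^sub>\<infinity>m. of_bool (even (m - J)) * E2 (int d * m))"
  proof -
    have "2 + 2 * \<i> \<noteq> 0" by (simp add: complex_eq_iff)
    then show ?thesis unfolding infsum_cmult_right' csqrt_\<beta> by simp
  qed
  finally show ?thesis unfolding infsum_parity[of "\<lambda>t. E2 (int d * t)"] .
qed

section \<open>The conjugate Fourier transform\<close>

text \<open>Poisson summation with a weight of period 4. The frequency \<kappa>/d centres the dual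
  Gaussian at 4\<kappa>/d, so in the variable 4\<kappa> - d m the dual series runs over a residue
  class modulo d.\<close>

lemma fourier_E:
  fixes \<kappa> :: int
  shows "(\<Sum>\<^sub>\<infinity>m. cis (2 * pi * (of_int \<kappa> / real d) * of_int m) * cnj (E m))
       = 2 * cis (- pi / 4) / csqrt (cnj \<beta> * (of_int 4)\<^sup>2) * f (4 * \<kappa>)"
proof -
  define w :: "int \<Rightarrow> complex" where "w t = cis (- (pi * of_int (t\<^sup>2) / of_int 4))" for t
  have wp: "w (t + 4) = w t" for t
  proof -
    have "[(t + 4)\<^sup>2 = t\<^sup>2] (mod (2 * 4))" by (simp add: cong_iff_dvd_diff power2_eq_square algebra_simps)
    from cis_cong_int[OF this] have "cnj (cis (pi * of_int ((t + 4)\<^sup>2) / of_int 4)) = cnj (cis (pi * of_int (t\<^sup>2) / of_int 4))" by simp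
    then show ?thesis unfolding w_def cis_cnj by simp
  qed
  have "cnj (E m) = w m * gauss_exp (cnj \<beta>) (of_int m)" for m
    by (simp add: E_def w_def cis_cnj cnj_gauss_exp)
  then have "(\<Sum>\<^sub>\<infinity>m. cis (2 * pi * (of_int \<kappa> / real d) * of_int m) * cnj (E m))
    = (\<Sum>\<^sub>\<infinity>m. w m * cis (2 * pi * (of_int \<kappa> / real d) * of_int m) * gauss_exp (cnj \<beta>) (of_int m))"
    by (simp add: mult_ac)
  also have "\<dots> = 1 / csqrt (cnj \<beta> * (of_int 4)\<^sup>2) *
         (\<Sum>\<^sub>\<infinity>m. (\<Sum>s\<in>{0..<4}. w s * cis (2 * pi * of_int m * of_int s / of_int 4)) *
                gauss_exp (1 / (cnj \<beta> * (of_int 4)\<^sup>2)) (of_int m - (of_int \<kappa> / real d) * of_int 4))"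
    by (rule poisson_gauss_weighted) (use Re_\<beta>_pos wp in auto)
  also have "\<dots> = 1 / csqrt (cnj \<beta> * (of_int 4)\<^sup>2) * (\<Sum>\<^sub>\<infinity>m. 2 * cis (- pi / 4) * E (4 * \<kappa> - int d * m))"
  proof -
    \<comment> \<open>This is |\<mu>|^2 = d once more: the dual Gaussian, stretched by d, has
      parameter \<beta> again.\<close>
    have "16 * \<beta> * cnj \<beta> * (of_nat d)\<^sup>2 = 1"
      using \<mu>_nonzero by (simp add: \<beta>_def norm_\<mu>[symmetric] field_simps)
    then have b: "1 / (cnj \<beta> * (of_int 4)\<^sup>2) * (of_real (- 1 / real d))\<^sup>2 = \<beta>"
      using d_pos by (auto simp: divide_eq_eq power_divide mult_ac)
    have "gauss_exp (1 / (cnj \<beta> * (of_int 4)\<^sup>2)) (of_int m - (of_int \<kappa> / real d) * of_int 4) = gauss_exp \<beta> (of_int (4 * \<kappa> - int d * m))" for m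
    proof -
      have "of_int m - (of_int \<kappa> / real d) * of_int 4 = (- 1 / real d) * of_int (4 * \<kappa> - int d * m)"
        using d_pos by (simp add: field_simps)
      then show ?thesis by (simp only: gauss_exp_scale b)
    qed
    moreover have "cis (pi * of_int (m\<^sup>2) / of_int 4) = cis (pi * of_int ((4 * \<kappa> - int d * m)\<^sup>2) / of_int 4)" for m
    proof (rule cis_cong_int)
      \<comment> \<open>An odd square is 1 modulo 8, seen here from d^2 = 4h(h+1) + 1 with h(h+1)
        even; the terms containing \<kappa> are multiples of 8.\<close>
      obtain h where h: "int d = 2 * h + 1" using odd_d by (metis even_of_nat oddE)
      have "even (h * (h + 1))" by simp
      then obtain q where q: "h * (h + 1) = 2 * q" by blast
      have "m\<^sup>2 - (4 * \<kappa> - int d * m)\<^sup>2 = - 16 * \<kappa>\<^sup>2 + 8 * \<kappa> * int d * m - 4 * (h * (h + 1)) * m\<^sup>2"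
        by (simp add: h power2_eq_square algebra_simps)
      also have "\<dots> = 8 * (- 2 * \<kappa>\<^sup>2 + \<kappa> * int d * m - q * m\<^sup>2)" unfolding q by (simp add: algebra_simps)
      finally show "[m\<^sup>2 = (4 * \<kappa> - int d * m)\<^sup>2] (mod (2 * 4))" by (simp add: cong_iff_dvd_diff)
    qed simp
    ultimately show ?thesis unfolding w_def gauss_sum_4 E_def by (simp add: mult_ac)
  qed
  also have "(\<Sum>\<^sub>\<infinity>m. 2 * cis (- pi / 4) * E (4 * \<kappa> - int d * m)) = 2 * cis (- pi / 4) * f (4 * \<kappa>)"
    unfolding infsum_cmult_right' f_def
    by (intro arg_cong2[where f="(*)"] refl infsum_reindex_bij_witness[of _ uminus uminus]) auto
  finally show ?thesis by simp
qed

text \<open>The transform takes f to a multiple of k -> f(4k). Doubling the argument of f halves the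
  frequency, and 4(k/2) = 2k modulo d restores the same function.\<close>

definition g :: "int \<Rightarrow> complex" where
  "g k = f (2 * k)"

lemma g_periodic: "g (k + int d) = g k"
  using f_periodic[of "2 * k"] f_periodic[of "2 * k + int d"] by (simp add: g_def algebra_simps)

lemma g_minus: "g (- k) = g k"
  using f_minus[of "2 * k"] by (simp add: g_def)

text \<open>The residues s = 2l exhaust the group, so the finite sum over l unfolds to the series
  over all integers in \<open>fourier_E\<close>, evaluated where 4\<kappa> is 2k modulo d.\<close>

lemma conj_fourier_g:
  "conj_fourier d g k = 2 * cis (- pi / 4) / csqrt (cnj \<beta> * (of_int 4)\<^sup>2) / of_real (sqrt (real d)) * g k"
proof -
  obtain h where h: "int d + 1 = 2 * h" using odd_d by (metis even_of_nat evenE odd_even_add odd_one)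
  \<comment> \<open>\<open>\<kappa>\<close> is \<open>k/2\<close> modulo \<open>d\<close>, so that \<open>k l \<equiv> \<kappa> m\<close> for every \<open>m \<equiv> 2l\<close>.\<close>
  define \<kappa> where "\<kappa> = k * h"
  define q where "q m = cis (2 * pi * (of_int \<kappa> / real d) * of_int m) * cnj (E m)" for m
  define Q where "Q s = (\<Sum>\<^sub>\<infinity>j. q (s + int d * j))" for s
  have "4 * \<kappa> = 2 * k + int d * (2 * k)"
  proof -
    have "4 * \<kappa> = 2 * k * (2 * h)" by (simp add: \<kappa>_def)
    then show ?thesis unfolding h[symmetric] by (simp add: algebra_simps)
  qed
  then have f\<kappa>: "f (4 * \<kappa>) = g k"
    using periodic_mult[of f "int d", OF f_periodic] by (simp add: g_def)
  have "(\<lambda>m. q m) summable_on UNIV"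
    by (rule abs_summable_summable) (use abs_summable_E in \<open>simp add: q_def norm_mult\<close>)
  then have "(\<Sum>\<^sub>\<infinity>m. q m) = (\<Sum>s\<in>{0..<int d}. Q s)"
    unfolding Q_def using d_pos by (intro infsum_int_residues) auto
  also have "\<dots> = (\<Sum>l\<in>{0..<int d}. Q (2 * l))"
  proof (rule sum_periodic_double[symmetric])
    show "Q (s + int d) = Q s" for s unfolding Q_def
      by (rule infsum_reindex_bij_witness[of _ "\<lambda>j. j - 1" "\<lambda>j. j + 1"]) (auto simp: algebra_simps)
  qed (use odd_d d_pos in auto)
  also have "\<dots> = (\<Sum>l\<in>{0..<int d}. exp (2 * \<i> * of_real pi * of_int k * of_int l / of_nat d) * cnj (g l))"
  proof (rule sum.cong[OF refl])
    fix l
    have "cis (2 * pi * (of_int \<kappa> / real d) * of_int (2 * l + int d * j)) = exp (2 * \<i> * of_real pi * of_int k * of_int l / of_nat d)" for j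
    proof -
      have "real_of_int (2 * \<kappa>) = real_of_int (k * (int d + 1))" unfolding h by (simp add: \<kappa>_def)
      then have e: "2 * of_int \<kappa> = of_int k * (real d + 1)" by simp
      have "2 * pi * (of_int \<kappa> / real d) * of_int (2 * l + int d * j) = pi * (2 * of_int \<kappa>) * of_int (2 * l + int d * j) / real d"
        by simp
      also have "\<dots> = pi * (2 * of_int l) * (of_int k * (real d + 1)) / real d + pi * of_int j * (2 * of_int \<kappa>)"
        unfolding e using d_pos by (simp add: field_simps)
      also have "\<dots> = 2 * pi * of_int k * of_int l / real d + 2 * pi * of_int (k * l + \<kappa> * j)"
        using d_pos by (simp add: field_simps)
      finally have "cis (2 * pi * (of_int \<kappa> / real d) * of_int (2 * l + int d * j)) = cis (2 * pi * of_int k * of_int l / real d)"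
        by (simp only: cis_mult[symmetric] cis_multiple_2pi[OF Ints_of_int]) simp
      then show ?thesis by (simp add: cis_conv_exp mult_ac)
    qed
    then have "Q (2 * l) = exp (2 * \<i> * of_real pi * of_int k * of_int l / of_nat d) * (\<Sum>\<^sub>\<infinity>j. cnj (E (2 * l + int d * j)))"
      unfolding Q_def q_def by (simp only: infsum_cmult_right')
    then show "Q (2 * l) = exp (2 * \<i> * of_real pi * of_int k * of_int l / of_nat d) * cnj (g l)"
      by (simp add: g_def f_def)
  qed
  finally have "(\<Sum>l\<in>{0..<int d}. exp (2 * \<i> * of_real pi * of_int k * of_int l / of_nat d) * cnj (g l)) = (\<Sum>\<^sub>\<infinity>m. q m)" ..
  then show ?thesis
    unfolding conj_fourier_def q_def fourier_E f\<kappa> by simp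
qed

text \<open>From |\<mu>|^2 = d one gets |\<beta>| = 1/(4d), so the complex root has modulus 2/sqrt
  d.\<close>

lemma norm_fourier_factor:
  "norm (2 * cis (- pi / 4) / csqrt (cnj \<beta> * (of_int 4)\<^sup>2) / of_real (sqrt (real d))) = 1"
proof -
  have "(norm \<mu>)\<^sup>2 = real d" using norm_\<mu> complex_norm_square[of \<mu>] by (metis of_real_eq_iff of_real_of_nat_eq)
  then have "norm (cnj \<beta> * (of_int 4)\<^sup>2) = 4 / real d"
    by (simp add: \<beta>_def norm_mult norm_divide norm_power)
  then have "norm (csqrt (cnj \<beta> * (of_int 4)\<^sup>2)) = sqrt (4 / real d)" by (simp only: norm_csqrt)
  then show ?thesis using d_pos by (simp add: norm_divide norm_mult real_sqrt_divide)
qed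

section \<open>The convolution identity\<close>

text \<open>Sum and difference variables separate the double theta series. The difference series is
  rescaled by \<open>E2_sum_scale\<close>, and the parallelogram identity read backwards reassembles
  the square.\<close>

lemma convolution_g: "Defs.convolution d g g (2 * k) = \<mu> * (g k)\<^sup>2"
proof -
  define H where "H s = f s * f (4 * k - s)" for s
  have Hp: "H (s + int d) = H s" for s
    using f_periodic[of s] f_periodic[of "4 * k - (s + int d)"] by (simp add: H_def algebra_simps)
  define Th where "Th J = (\<Sum>\<^sub>\<infinity>u. E2 (2 * u - J))" for J
  have Th_cong: "Th J = Th J'" if ev: "even (J - J')" for J J'
  proof -
    obtain c where c: "J - J' = 2 * c" using ev by (elim evenE)
    show ?thesis unfolding Th_def
      by (rule infsum_reindex_bij_witness[of _ "\<lambda>u. u + c" "\<lambda>u. u - c"]) (use c in \<open>auto simp: algebra_simps\<close>)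
  qed
  have d0: "int d \<noteq> 0" using d_pos by simp
  have "Defs.convolution d g g (2 * k) = (\<Sum>l\<in>{0..<int d}. H (2 * l))"
    unfolding Defs.convolution_def H_def g_def by (simp add: algebra_simps)
  also have "\<dots> = (\<Sum>s\<in>{0..<int d}. H s)"
    by (rule sum_periodic_double) (use odd_d d_pos Hp in auto)
  \<comment> \<open>As f(4k - u) depends only on u modulo d, expanding f(s) merges the residue s and
    the index i into a single integer u.\<close>
  also have "\<dots> = (\<Sum>s\<in>{0..<int d}. \<Sum>\<^sub>\<infinity>i. E (s + int d * i) * f (4 * k - (s + int d * i)))"
  proof (rule sum.cong[OF refl])
    fix s
    have "f (4 * k - (s + int d * i)) = f (4 * k - s)" for i
      using periodic_mult[of f "int d", OF f_periodic, of "4 * k - s" "- i"] by (simp add: algebra_simps)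
    then show "H s = (\<Sum>\<^sub>\<infinity>i. E (s + int d * i) * f (4 * k - (s + int d * i)))"
      by (simp add: H_def infsum_cmult_left') (simp add: f_def)
  qed
  also have "\<dots> = (\<Sum>\<^sub>\<infinity>u. E u * f (4 * k - u))"
  proof (rule infsum_int_residues[symmetric])
    have "inj (\<lambda>x::int \<times> int. (fst x, 4 * k - fst x + int d * snd x))"
      using d0 by (auto simp: inj_def)
    from summable_E_pair[OF this]
    have "(\<lambda>(u, j). E u * E (4 * k - u + int d * j)) summable_on UNIV \<times> UNIV" by (simp add: case_prod_unfold)
    from summable_on_Sigma_banach[OF this] show "(\<lambda>u. E u * f (4 * k - u)) summable_on UNIV"
      by (simp add: f_def infsum_cmult_right')
  qed (use d_pos in simp)
  also have "\<dots> = (\<Sum>\<^sub>\<infinity>u. \<Sum>\<^sub>\<infinity>j. E2 (4 * k + int d * j) * E2 (2 * u - (4 * k + int d * j)))"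
  proof (rule infsum_cong)
    fix u
    have "E u * E (4 * k - u + int d * j) = E2 (4 * k + int d * j) * E2 (2 * u - (4 * k + int d * j))" for j
      unfolding E_mult_E by (rule arg_cong2[where f="(*)"]) (auto intro!: arg_cong[where f=E2])
    then show "E u * f (4 * k - u) = (\<Sum>\<^sub>\<infinity>j. E2 (4 * k + int d * j) * E2 (2 * u - (4 * k + int d * j)))"
      unfolding f_def infsum_cmult_right'[symmetric] by simp
  qed
  also have "\<dots> = (\<Sum>\<^sub>\<infinity>j. \<Sum>\<^sub>\<infinity>u. E2 (4 * k + int d * j) * E2 (2 * u - (4 * k + int d * j)))"
  proof (rule infsum_swap_banach)
    have "inj (\<lambda>x::int \<times> int. (fst x, 4 * k - fst x + int d * snd x))"
      using d0 by (auto simp: inj_def)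
    from summable_E_pair[OF this]
    show "(\<lambda>(u, j). E2 (4 * k + int d * j) * E2 (2 * u - (4 * k + int d * j))) summable_on UNIV \<times> UNIV"
      unfolding E_mult_E by (simp add: case_prod_unfold algebra_simps)
  qed
  also have "\<dots> = (\<Sum>\<^sub>\<infinity>j. E2 (4 * k + int d * j) * Th j)"
  proof (rule infsum_cong)
    fix j
    \<comment> \<open>Only the parity of 4k + dj matters, and it is that of j because d is odd.
      Taking j as representative makes the rescaled terms E2(d(2i - j)), which can be recombined
      with E2(4k + dj).\<close>
    have "Th (4 * k + int d * j) = Th j" using odd_d by (intro Th_cong) simp
    then show "(\<Sum>\<^sub>\<infinity>u. E2 (4 * k + int d * j) * E2 (2 * u - (4 * k + int d * j))) = E2 (4 * k + int d * j) * Th j"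
      unfolding infsum_cmult_right' Th_def by simp
  qed
  also have "\<dots> = \<mu> * (\<Sum>\<^sub>\<infinity>j. \<Sum>\<^sub>\<infinity>i. E2 (4 * k + int d * j) * E2 (int d * (2 * i - j)))"
    unfolding Th_def E2_sum_scale infsum_cmult_right'[symmetric] by (simp add: mult_ac)
  also have "(\<Sum>\<^sub>\<infinity>j. \<Sum>\<^sub>\<infinity>i. E2 (4 * k + int d * j) * E2 (int d * (2 * i - j)))
     = (\<Sum>\<^sub>\<infinity>i. \<Sum>\<^sub>\<infinity>j. E2 (4 * k + int d * j) * E2 (int d * (2 * i - j)))"
  proof (rule infsum_swap_banach)
    \<comment> \<open>The numbers 4k + dj and d(2i - j) are the sum and the difference of 2k + di
      and 2k + d(j - i), with (j, i) as index pair.\<close>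
    have "inj (\<lambda>x::int \<times> int. (2 * k + int d * snd x, 2 * k + int d * (fst x - snd x)))"
      using d0 by (auto simp: inj_def)
    from summable_E_pair[OF this]
    show "(\<lambda>(j, i). E2 (4 * k + int d * j) * E2 (int d * (2 * i - j))) summable_on UNIV \<times> UNIV"
      unfolding E_mult_E by (simp add: case_prod_unfold algebra_simps)
  qed
  also have "\<dots> = (\<Sum>\<^sub>\<infinity>i. E (2 * k + int d * i) * f (2 * k))"
  proof (rule infsum_cong)
    fix i
    have "(\<Sum>\<^sub>\<infinity>j. E2 (4 * k + int d * j) * E2 (int d * (2 * i - j))) = (\<Sum>\<^sub>\<infinity>j. E (2 * k + int d * i) * E (2 * k + int d * (j - i)))"
      unfolding E_mult_E by (simp add: algebra_simps)
    also have "\<dots> = E (2 * k + int d * i) * (\<Sum>\<^sub>\<infinity>j. E (2 * k + int d * (j - i)))"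
      by (rule infsum_cmult_right')
    also have "(\<Sum>\<^sub>\<infinity>j. E (2 * k + int d * (j - i))) = f (2 * k)" unfolding f_def
      by (rule infsum_reindex_bij_witness[of _ "\<lambda>j. j + i" "\<lambda>j. j - i"]) auto
    finally show "(\<Sum>\<^sub>\<infinity>j. E2 (4 * k + int d * j) * E2 (int d * (2 * i - j))) = E (2 * k + int d * i) * f (2 * k)" .
  qed
  also have "\<dots> = (g k)\<^sup>2" unfolding infsum_cmult_left' by (simp add: g_def f_def power2_eq_square)
  finally show ?thesis .
qed

section \<open>Non-vanishing\<close>

text \<open>In the series for f(0) the central term is 1, and the other terms together have norm
  less than 1.\<close>

lemma g_nonzero: "g 0 \<noteq> 0"
proof
  assume "g 0 = 0"
  then have 0: "(\<Sum>\<^sub>\<infinity>j. E (int d * j)) = 0" by (simp add: g_def f_def)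
  \<comment> \<open>The bound Im(\<mu>^2) >= 2 makes the j-th term at most exp(-(pi/2) j^2) in norm.
    The tail 2r/(1-r) is below 1 exactly when r < 1/3, which the quadratic Taylor bound for
    exp(pi/2) gives.\<close>
  define r where "r = exp (- pi / 2)"
  have r: "0 < r" "r < 1 / 3"
  proof -
    have "3 < 1 + pi / 2 + (pi / 2)\<^sup>2 / 2"
      using pi_gt3 mult_strict_mono[of 3 pi 3 pi] by (simp add: power2_eq_square)
    also have "\<dots> \<le> exp (pi / 2)" by (rule exp_lower_Taylor_quadratic) simp
    finally show "r < 1 / 3" by (simp add: r_def exp_minus field_simps)
  qed (simp add: r_def)
  have bound: "norm (E (int d * j)) \<le> r ^ nat \<bar>j\<bar>" for j
  proof -
    have "real_of_int \<bar>j\<bar> \<le> (real_of_int j)\<^sup>2" using abs_of_int_le_power2[of j] by simp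
    also have "(real_of_int j)\<^sup>2 \<le> (Im (\<mu>\<^sup>2) / 2) * (real_of_int j)\<^sup>2" using Im_\<mu>2 by (intro mult_left_mono[of 1, simplified mult_1] mult_right_mono[of 1 _ "(real_of_int j)\<^sup>2", simplified]) auto
    also have "\<dots> = 2 * (Re \<beta> * (of_int (int d * j))\<^sup>2)" unfolding Re_\<beta> using d_pos by (simp add: power_mult_distrib)
    finally have "pi * real_of_int \<bar>j\<bar> \<le> pi * (2 * (Re \<beta> * (of_int (int d * j))\<^sup>2))" by (intro mult_left_mono) auto
    then have "norm (E (int d * j)) \<le> exp (- pi / 2 * real_of_int \<bar>j\<bar>)" by (simp add: norm_E algebra_simps)
    also have "\<dots> = r ^ nat \<bar>j\<bar>" unfolding r_def exp_of_nat_mult[symmetric] by (simp add: mult.commute)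
    finally show ?thesis .
  qed
  have geo: "((\<lambda>n. r ^ n) has_sum (r / (1 - r))) {1..}"
    by (rule has_sum_geometric_from_1) (use r in auto)
  have "((\<lambda>j. r ^ nat \<bar>j\<bar>) has_sum (r / (1 - r))) {1..}"
    by (rule has_sum_reindex_bij_witness[of _ int nat, THEN iffD2, OF _ _ _ _ _ refl geo]) auto
  moreover have "((\<lambda>j. r ^ nat \<bar>j\<bar>) has_sum (r / (1 - r))) {..-1}"
    by (rule has_sum_reindex_bij_witness[of _ "\<lambda>n. - int n" "\<lambda>j. nat (- j)", THEN iffD2, OF _ _ _ _ _ refl geo]) auto
  ultimately have "((\<lambda>j. r ^ nat \<bar>j\<bar>) has_sum (r / (1 - r) + r / (1 - r))) ({1..} \<union> {..-1::int})"
    by (rule has_sum_Un_disjoint) auto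
  moreover have "{1..} \<union> {..-1::int} = UNIV - {0}" by auto
  ultimately have S: "((\<lambda>j::int. r ^ nat \<bar>j\<bar>) has_sum (2 * r / (1 - r))) (UNIV - {0})" by simp
  have sm: "(\<lambda>j. E (int d * j)) summable_on UNIV"
    by (rule summable_E_inj) (use d_pos in \<open>auto simp: inj_def\<close>)
  then have "(\<Sum>\<^sub>\<infinity>j. E (int d * j)) = E 0 + (\<Sum>\<^sub>\<infinity>j\<in>UNIV - {0}. E (int d * j))"
    using infsum_insert[of "\<lambda>j. E (int d * j)" "UNIV - {0}" 0] summable_on_subset_banach[OF sm, of "UNIV - {0}"]
    by (simp add: insert_UNIV)
  then have "norm (\<Sum>\<^sub>\<infinity>j\<in>UNIV - {0}. E (int d * j)) = 1"
    using 0 by (simp add: E_def add_eq_0_iff)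
  moreover have "norm (\<Sum>\<^sub>\<infinity>j\<in>UNIV - {0}. E (int d * j)) \<le> 2 * r / (1 - r)"
    by (rule norm_infsum_le[OF has_sum_infsum S bound]) (rule summable_on_subset_banach[OF sm], simp)
  ultimately show False using r by (simp add: field_simps)
qed

section \<open>Normalisation and conjugation\<close>

theorem in_B_o: "\<mu> \<in> B_o d" "cnj \<mu> \<in> B_o d"
proof -
  define c where "c = 2 * cis (- pi / 4) / csqrt (cnj \<beta> * (of_int 4)\<^sup>2) / of_real (sqrt (real d))"
  \<comment> \<open>The transform is antilinear, so it takes u g to cnj(u) c g. With u^2 = c and |u|
    = 1 the factor cnj(u) c is u again.\<close>
  define u where "u = csqrt c"
  have u2: "u\<^sup>2 = c" by (simp add: u_def)
  have "norm u = 1" using norm_fourier_factor by (simp add: u_def c_def norm_csqrt)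
  then have uu: "cnj u * u = 1" by (metis complex_norm_square mult.commute of_real_1 power_one)
  then have u0: "u \<noteq> 0" by auto
  define F where "F k = u * g k" for k
  have F_zmod: "F (k + int d) = F k" for k by (simp add: F_def g_periodic)
  have F0: "F 0 \<noteq> 0" using u0 g_nonzero by (simp add: F_def)
  have F_conv: "Defs.convolution d F F (2 * k) = \<mu> * (F k)\<^sup>2" for k
  proof -
    have "Defs.convolution d F F (2 * k) = u\<^sup>2 * Defs.convolution d g g (2 * k)"
      by (simp add: Defs.convolution_def F_def sum_distrib_left power2_eq_square mult_ac)
    then show ?thesis by (simp add: convolution_g F_def power_mult_distrib)
  qed
  have F_fourier: "conj_fourier d F k = F k" for k
  proof -
    have "conj_fourier d F k = cnj u * conj_fourier d g k"
      by (simp add: conj_fourier_def F_def sum_distrib_left mult_ac)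
    also have "\<dots> = (cnj u * u) * u * g k"
      unfolding conj_fourier_g c_def[symmetric] u2[symmetric] by (simp add: power2_eq_square)
    finally show ?thesis by (simp add: uu F_def)
  qed
  have "critical_fun d \<mu> F"
    unfolding critical_fun_def zmod_funs_def using F_zmod F0 F_conv by auto
  then show "\<mu> \<in> B_o d" unfolding B_o_def using F_fourier by blast
  \<comment> \<open>The conjugate of F serves for cnj \<mu>. Its transform at k is the conjugate of
    the transform of F at -k, and F is even.\<close>
  have "Defs.convolution d (\<lambda>k. cnj (F k)) (\<lambda>k. cnj (F k)) (2 * k) = cnj (Defs.convolution d F F (2 * k))" for k
    by (simp add: Defs.convolution_def)
  then have "critical_fun d (cnj \<mu>) (\<lambda>k. cnj (F k))"
    unfolding critical_fun_def zmod_funs_def using F_zmod F0 F_conv by (auto simp: fun_eq_iff)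
  moreover have "conj_fourier d (\<lambda>k. cnj (F k)) k = cnj (F k)" for k
  proof -
    have "conj_fourier d (\<lambda>k. cnj (F k)) k = cnj (conj_fourier d F (- k))"
      by (simp add: conj_fourier_def exp_cnj)
    also have "F (- k) = F k" by (simp add: F_def g_minus)
    then have "cnj (conj_fourier d F (- k)) = cnj (F k)" by (simp add: F_fourier)
    finally show ?thesis .
  qed
  ultimately show "cnj \<mu> \<in> B_o d" unfolding B_o_def by blast
qed

end

theorem theorem1p8:
  fixes d a b :: nat
  assumes "odd d"
    and "a > 0" and "b > 0"
    and "a + b = d"
    and "[a = (d + 1)\<^sup>2 div 4] (mod 4)"
  shows "complex_of_real (sqrt (real a)) + \<i> * complex_of_real (sqrt (real b)) \<in> B_o d
       \<and> complex_of_real (sqrt (real a)) - \<i> * complex_of_real (sqrt (real b)) \<in> B_o d"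
proof -
  define \<mu> where "\<mu> = complex_of_real (sqrt (real a)) + \<i> * complex_of_real (sqrt (real b))"
  have sq: "\<mu>\<^sup>2 = Complex (real a - real b) (2 * sqrt (real a * real b))"
    by (simp add: \<mu>_def complex_eq_iff power2_eq_square real_sqrt_mult)
  interpret critical_theta d "int a - int b" \<mu>
  proof
    show "odd d" by fact
    show "0 < Re \<mu>" "0 < Im \<mu>" using assms(2,3) by (simp_all add: \<mu>_def)
    show "\<mu> * cnj \<mu> = of_nat d" using assms(4) by (auto simp: \<mu>_def complex_eq_iff)
    show "Re (\<mu>\<^sup>2) = of_int (int a - int b)" by (simp add: sq)
    have "1 \<le> real a * real b" using assms(2,3) by (metis nat_0_less_mult_iff of_nat_mult One_nat_def Suc_leI of_nat_1 of_nat_le_iff)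
    then show "2 \<le> Im (\<mu>\<^sup>2)" by (simp add: sq)
    \<comment> \<open>With d + 1 = 2h the hypothesis reads a = h^2 modulo 4, and substituting b = d
      - a turns the expression in question into 4(h^2 - a).\<close>
    obtain h where h: "d + 1 = 2 * h" using assms(1) by (metis evenE odd_even_add odd_one)
    have "(d + 1)\<^sup>2 div 4 = h\<^sup>2" unfolding h by (simp add: power_mult_distrib)
    then have "[int a = (int h)\<^sup>2] (mod 4)" using assms(5) by (metis cong_int_iff of_nat_numeral of_nat_power)
    then obtain q where q: "int a - (int h)\<^sup>2 = 4 * q" by (metis cong_iff_dvd_diff dvdE)
    have hd: "int d = 2 * int h - 1" using h by linarith
    have "int b = int d - int a" using assms(4) by simp
    then have "(int d)\<^sup>2 - 2 * (int a - int b) + 1 = - 4 * (int a - (int h)\<^sup>2)"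
      by (simp add: hd power2_eq_square algebra_simps)
    also have "\<dots> = 16 * (- q)" unfolding q by simp
    finally show "16 dvd (int d)\<^sup>2 - 2 * (int a - int b) + 1" by simp
  qed
  have "cnj \<mu> = complex_of_real (sqrt (real a)) - \<i> * complex_of_real (sqrt (real b))"
    by (simp add: \<mu>_def)
  then show ?thesis using in_B_o by (simp add: \<mu>_def)
qed

end
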